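(* Suppose the arrival probabilities $\boldsymbol p$ are known. Let $M$ be a positive integer, $\epsilon>0$ and $\beta\in(\tfrac12,1)$, and run the AIR-KP policy with resolving set $\mathcal T^{\mathcal K,F}(M)=\{1\}\cup\{\lceil T-T^{\beta^k}\rceil: k=1,\dots,M-1\}$. Then the regret of the AIR-KP policy is $\mathcal O\big(T^{(1/2+\epsilon)\beta^{M-1}}\big)$.
   Context: Setting: $m$ resources, $n$ customer types; type $j$ has reward $r_j\ge0$ and consumption $\boldsymbol A_j\in\mathbb R_+^m$ (columns of $\boldsymbol A$); $T$ periods; initial inventory $T\boldsymbol\rho$, $\boldsymbol\rho\in\mathbb R^m_+$. Each period one customer arrives with type drawn i.i.d. from a known $\boldsymbol p$ ($p_j>0$ for all $j$). Each arrival is irrevocably accepted (consuming $\boldsymbol A_j$, earning $r_j$) or rejected, never exceeding the inventory. $V^*(T)$ is the optimal expected reward over feasible non-anticipative policies; the regret of a policy is $V^*(T)$ minus its expected reward. $\phi(\boldsymbol b,\boldsymbol d)=\max\{\boldsymbol r^\top\boldsymbol y:\boldsymbol A\boldsymbol y\le\boldsymbol b,\ \boldsymbol 0\le\boldsymbol y\le\boldsymbol d\}$. AIR-KP policy with resolving set $\mathcal T$: maintain inventory $\boldsymbol b^t$ ($\boldsymbol b^1=T\boldsymbol\rho$) and $\boldsymbol u^t,\boldsymbol d^t$ ($\boldsymbol u^1=\boldsymbol d^1=\boldsymbol 0$). In period $t$: if $t\in\mathcal T$, take an optimal solution $\boldsymbol y^*$ of $\phi(\boldsymbol b^t,(T-t+1)\boldsymbol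 p)$ and reset $\boldsymbol u^t=\boldsymbol y^*$, $\boldsymbol d^t=(T-t+1)\boldsymbol p$. Observe type $j$; if $\boldsymbol A_j\le\boldsymbol b^t$, $u^t_j>1$ and $u^t_j\ge d^t_j-u^t_j$, accept, $\boldsymbol b^{t+1}=\boldsymbol b^t-\boldsymbol A_j$, $\boldsymbol u^{t+1}=\boldsymbol u^t-\boldsymbol e_j$; otherwise reject, $\boldsymbol b^{t+1}=\boldsymbol b^t$, $\boldsymbol u^{t+1}=\boldsymbol u^t$. Always $\boldsymbol d^{t+1}=\boldsymbol d^t-\boldsymbol e_j$. $\mathcal O(f(T))$ means at most $Cf(T)$ with $C$ independent of $T$. *)

theory Defs
  imports "HOL-Probability.Probability"
begin

text \<open>
  An instance consists of the consumption matrix \<open>A\<close> (rows are the resources \<open>'m\<close>, columns the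
  customer types \<open>'n\<close>), the rewards \<open>r\<close>, the per-period inventory \<open>\<rho>\<close>, the arrival distribution \<open>p\<close>
  and the horizon \<open>T\<close>. The order on vectors is componentwise. Periods are numbered \<open>1, \<dots>, T\<close>; the
  period in which a decision is taken is \<open>length h + 1\<close>, where \<open>h\<close> lists the types of the
  earlier arrivals.
\<close>

text \<open>
  A policy decides (True = accept) from the earlier arrivals and the type of the current one.
  Earlier decisions need not be part of the argument, since they are determined by these.
\<close>

type_synonym 'n policy = "'n list \<Rightarrow> 'n \<Rightarrow> bool"

definition inventory ::
  "real^'n^'m \<Rightarrow> real^'m \<Rightarrow> nat \<Rightarrow> 'n policy \<Rightarrow> 'n list \<Rightarrow> real^'m" where
  "inventory A \<rho> T \<pi> h = real T *\<^sub>R \<rho> -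
     (\<Sum>s<length h. if \<pi> (take s h) (h ! s) then column (h ! s) A else 0)"

definition feasible_policy ::
  "real^'n^'m \<Rightarrow> real^'m \<Rightarrow> nat \<Rightarrow> 'n policy \<Rightarrow> bool" where
  "feasible_policy A \<rho> T \<pi> \<longleftrightarrow>
     (\<forall>h j. length h < T \<longrightarrow> \<pi> h j \<longrightarrow> column j A \<le> inventory A \<rho> T \<pi> h)"

definition total_reward :: "real^'n \<Rightarrow> 'n policy \<Rightarrow> 'n list \<Rightarrow> real" where
  "total_reward r \<pi> \<omega> = (\<Sum>s<length \<omega>. if \<pi> (take s \<omega>) (\<omega> ! s) then r $ (\<omega> ! s) else 0)"

definition expected_reward ::
  "real^'n \<Rightarrow> 'n pmf \<Rightarrow> nat \<Rightarrow> 'n policy \<Rightarrow> real" where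
  "expected_reward r p T \<pi> = measure_pmf.expectation (replicate_pmf T p) (total_reward r \<pi>)"

text \<open>
  Randomised policies are admitted in the benchmark: \<open>q\<close> is a distribution over feasible policies,
  drawn independently of the arrivals. The supremum is over a nonempty bounded set, because
  rejecting everyone is feasible if \<open>\<rho> \<ge> 0\<close> and the reward is at most \<open>T\<close> times the largest \<open>r $ j\<close>.
\<close>

definition opt_value ::
  "real^'n^'m \<Rightarrow> real^'n \<Rightarrow> real^'m \<Rightarrow> 'n pmf \<Rightarrow> nat \<Rightarrow> real" where
  "opt_value A r \<rho> p T =
     (SUP q \<in> {q :: 'n policy pmf. \<forall>\<pi> \<in> set_pmf q. feasible_policy A \<rho> T \<pi>}.
        measure_pmf.expectation q (expected_reward r p T))"

definition regret ::
  "real^'n^'m \<Rightarrow> real^'n \<Rightarrow> real^'m \<Rightarrow> 'n pmf \<Rightarrow> nat \<Rightarrow> 'n policy \<Rightarrow> real" where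
  "regret A r \<rho> p T \<pi> = opt_value A r \<rho> p T - expected_reward r p T \<pi>"

definition lp_feasible :: "real^'n^'m \<Rightarrow> real^'m \<Rightarrow> real^'n \<Rightarrow> real^'n \<Rightarrow> bool" where
  "lp_feasible A b d y \<longleftrightarrow> A *v y \<le> b \<and> 0 \<le> y \<and> y \<le> d"

definition lp_optimal :: "real^'n^'m \<Rightarrow> real^'n \<Rightarrow> real^'m \<Rightarrow> real^'n \<Rightarrow> real^'n \<Rightarrow> bool" where
  "lp_optimal A r b d y \<longleftrightarrow> is_arg_max (\<lambda>y. r \<bullet> y) (lp_feasible A b d) y"

text \<open>
  An LP solver returns some optimal solution; which one, when there are several, may depend on
  the earlier arrivals \<open>h\<close>. For \<open>b, d \<ge> 0\<close> an optimal solution exists whenever \<open>A \<ge> 0\<close>.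
\<close>

type_synonym ('m, 'n) solver = "'n list \<Rightarrow> real^'m \<Rightarrow> real^'n \<Rightarrow> real^'n"

definition lp_solver :: "real^'n^'m \<Rightarrow> real^'n \<Rightarrow> ('m, 'n) solver \<Rightarrow> bool" where
  "lp_solver A r sol \<longleftrightarrow> (\<forall>h b d. 0 \<le> b \<longrightarrow> 0 \<le> d \<longrightarrow> lp_optimal A r b d (sol h b d))"

text \<open>The state of AIR-KP is the triple \<open>(b, u, d)\<close>.\<close>

type_synonym ('m, 'n) airkp_state = "(real^'m) \<times> (real^'n) \<times> (real^'n)"

definition airkp_resolve ::
  "'n pmf \<Rightarrow> ('m, 'n) solver \<Rightarrow> nat set \<Rightarrow> nat \<Rightarrow> 'n list \<Rightarrow>
   ('m, 'n) airkp_state \<Rightarrow> ('m::finite, 'n::finite) airkp_state" where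
  "airkp_resolve p sol R T h = (\<lambda>(b, u, d).
     let t = length h + 1; d' = real (T - t + 1) *\<^sub>R (\<chi> j. pmf p j)
     in if t \<in> R then (b, sol h b d', d') else (b, u, d))"

definition airkp_accepts ::
  "real^'n^'m \<Rightarrow> ('m, 'n) airkp_state \<Rightarrow> 'n \<Rightarrow> bool" where
  "airkp_accepts A = (\<lambda>(b, u, d) j. column j A \<le> b \<and> u $ j > 1 \<and> u $ j \<ge> d $ j - u $ j)"

definition airkp_update ::
  "real^'n^'m \<Rightarrow> ('m, 'n) airkp_state \<Rightarrow> 'n \<Rightarrow> ('m, 'n) airkp_state" where
  "airkp_update A = (\<lambda>(b, u, d) j.
     if airkp_accepts A (b, u, d) j then (b - column j A, u - axis j 1, d - axis j 1)
     else (b, u, d - axis j 1))"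

text \<open>\<open>airkp_state A \<rho> p sol R T h k\<close> is the state at the start of period \<open>k + 1\<close>, before any
  re-solving in that period, when the arrivals of periods \<open>1, \<dots>, k\<close> are the first \<open>k\<close> entries
  of \<open>h\<close>. Here \<open>R\<close> is the set of periods in which the LP is re-solved.\<close>

primrec airkp_state ::
  "real^'n^'m \<Rightarrow> real^'m \<Rightarrow> 'n pmf \<Rightarrow> ('m, 'n) solver \<Rightarrow> nat set \<Rightarrow> nat \<Rightarrow>
   'n list \<Rightarrow> nat \<Rightarrow> ('m::finite, 'n::finite) airkp_state" where
  "airkp_state A \<rho> p sol R T h 0 = (real T *\<^sub>R \<rho>, 0, 0)"
| "airkp_state A \<rho> p sol R T h (Suc k) =
     airkp_update A
       (airkp_resolve p sol R T (take k h) (airkp_state A \<rho> p sol R T h k)) (h ! k)"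

definition airkp_policy ::
  "real^'n^'m \<Rightarrow> real^'m \<Rightarrow> 'n pmf \<Rightarrow> ('m, 'n) solver \<Rightarrow> nat set \<Rightarrow> nat \<Rightarrow>
   ('n::finite) policy" where
  "airkp_policy A \<rho> p sol R T h j =
     airkp_accepts A
       (airkp_resolve p sol R T h (airkp_state A \<rho> p sol R T h (length h))) j"

text \<open>For \<open>T \<ge> 1\<close> and \<open>0 < \<beta> < 1\<close> the ceilings below are nonnegative, so \<open>nat\<close> loses nothing;
  the value 0, which occurs only for \<open>T = 1\<close>, is not a period and has no effect.\<close>

definition resolving_set :: "nat \<Rightarrow> real \<Rightarrow> nat \<Rightarrow> nat set" where
  "resolving_set M \<beta> T =
     {1} \<union> (\<lambda>k. nat \<lceil>real T - real T powr (\<beta> ^ k)\<rceil>) ` {1..M - 1}"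

end

(*
  Within an epoch between two resolving times the policy's residual plan u is always optimal for
  the fluid problem with the current inventory and the planned demand d minus the arrivals so far.
  That demand differs from the demand that will actually arrive by the same vector throughout the
  epoch, namely the deviation of the demand from its mean at the last resolving time. With L periods
  left there, this is of order L^(1/2), whereas at least L^beta periods, beta > 1/2, are left at the
  end of the epoch. Optimal solutions are Lipschitz in the demand, and the threshold rule accepts
  type j only if u_j is at least d_j / 2 and rejects it only if d_j - u_j is about d_j / 2 or more.
  Hence, except on an event of superpolynomially small probability, each decision of the policy
  agrees with some hindsight optimum and loses nothing relative to the hindsight value. All regret
  thus arises after the last resolving time, with about T^(beta^(M-1)) periods left, where the loss
  is at most linear in the deviation of the demand and so of the order of the square root.
*)
theory Submission
  imports Defs "HOL-Real_Asymp.Real_Asymp"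
begin

section \<open>Sensitivity of optimal solutions\<close>

text \<open>The inventory along a path is random and the program may be degenerate with many optimal
  solutions, so no fixed basis is available. Stability is therefore stated for a given optimum:
  whatever solution \<open>u\<close> the solver returned for the planned demand, some optimum for
  the true demand lies near it, with a constant that depends on \<open>A\<close> only. This form
  suffices, because a decision that agrees with one hindsight optimum preserves the hindsight value.
  It preserves it exactly, so no error accumulates over the periods, and a failure costs at most a
  multiple of \<open>T\<close>, which its small probability outweighs. The constant comes from
  cutting the difference of two solutions into pieces whose signs, and those of their images under
  \<open>A\<close>, agree with the difference; each piece is a multiple of one of finitely many
  vectors. The condition \<open>1 / 2 < \<beta>\<close> makes the exponent
  \<open>2 * \<beta> ^ Suc i - \<beta> ^ i\<close> positive, so that deviations at scale
  \<open>T powr (\<beta> ^ Suc i)\<close> are rare among about \<open>T powr (\<beta> ^ i)\<close>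
  arrivals.\<close>

definition conformal :: "real^'k \<Rightarrow> real^'k \<Rightarrow> bool" where
  "conformal h z \<longleftrightarrow> (\<forall>i. min 0 (z $ i) \<le> h $ i \<and> h $ i \<le> max 0 (z $ i))"

lemma sum_same_sign_between:
  fixes h :: "'a \<Rightarrow> real"
  assumes "finite G" "g \<in> G" "s = 1 \<or> s = -1" "\<And>g. g \<in> G \<Longrightarrow> s * h g \<ge> 0"
  shows "min 0 (sum h G) \<le> h g \<and> h g \<le> max 0 (sum h G)"
proof -
  have "s * h g \<le> (\<Sum>g\<in>G. s * h g)"
    using assms by (intro member_le_sum) auto
  also have "\<dots> = s * sum h G"
    by (simp add: sum_distrib_left)
  finally show ?thesis
    using assms(3) assms(4)[OF assms(2)] by auto
qed

text \<open>On a cone with fixed signs the l1 norm is a linear form, so cutting it at 1 keeps the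
  set polyhedral and makes it bounded.\<close>

lemma polytope_sign_pattern:
  fixes A :: "real^'n^'m" and s :: "'n \<Rightarrow> real" and t :: "'m \<Rightarrow> real"
  assumes "\<And>j. s j = 1 \<or> s j = -1"
  shows "polytope {z. (\<forall>j. s j * z $ j \<ge> 0) \<and> (\<forall>i. t i * (A *v z) $ i \<ge> 0) \<and>
            (\<Sum>j\<in>UNIV. s j * z $ j) \<le> 1}" (is "polytope ?P")
proof -
  have e1: "(s j *\<^sub>R axis j 1) \<bullet> z = s j * z $ j" for j z
    by (simp add: inner_axis')
  have e2: "(t i *\<^sub>R A $ i) \<bullet> z = t i * (A *v z) $ i" for i z
    by (simp add: matrix_vector_mul_component)
  have e3: "(\<chi> j. s j) \<bullet> z = (\<Sum>j\<in>UNIV. s j * z $ j)" for z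
    by (simp add: inner_vec_def)
  have eq: "?P = \<Inter> (range (\<lambda>j. {z. (s j *\<^sub>R axis j 1) \<bullet> z \<ge> 0}) \<union>
      range (\<lambda>i. {z. (t i *\<^sub>R A $ i) \<bullet> z \<ge> 0}) \<union> {{z. (\<chi> j. s j) \<bullet> z \<le> 1}})"
    unfolding e1 e2 e3 by (auto simp: ball_Un)
  have "polyhedron ?P"
    unfolding eq by (intro polyhedron_Inter) (auto simp: polyhedron_halfspace_ge polyhedron_halfspace_le simp del: inner_scaleR_left)
  moreover have "norm z \<le> 1" if "z \<in> ?P" for z
  proof -
    have "norm z \<le> (\<Sum>j\<in>UNIV. \<bar>z $ j\<bar>)"
      by (rule norm_le_l1_cart)
    also have "\<dots> = (\<Sum>j\<in>UNIV. s j * z $ j)"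
    proof (intro sum.cong refl)
      fix j show "\<bar>z $ j\<bar> = s j * z $ j"
        using that assms[of j] by (auto dest!: spec[of _ j])
    qed
    finally show ?thesis
      using that by simp
  qed
  hence "bounded ?P"
    by (auto simp: bounded_iff)
  ultimately show ?thesis
    by (simp add: polytope_eq_bounded_polyhedron)
qed

text \<open>The generators are the vertices of the truncated sign cones, of which there are finitely
  many; this is why the ratio bound \<open>K\<close> does not depend on \<open>z\<close>.\<close>

lemma conformal_decomposition:
  fixes A :: "real^'n^'m"
  obtains K where "K \<ge> 0"
    "\<And>z. \<exists>(G :: (real^'n) set) h. finite G \<and> z = sum h G \<and>
      (\<forall>g\<in>G. conformal (h g) z \<and> conformal (A *v h g) (A *v z) \<and>
        (\<forall>j k. h g $ j \<noteq> 0 \<longrightarrow> \<bar>h g $ k\<bar> \<le> K * \<bar>h g $ j\<bar>))"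
proof -
  define S where "S = (UNIV :: 'n set) \<rightarrow>\<^sub>E {1, -1 :: real}"
  define S' where "S' = (UNIV :: 'm set) \<rightarrow>\<^sub>E {1, -1 :: real}"
  define P where "P s t = {z. (\<forall>j. s j * z $ j \<ge> 0) \<and> (\<forall>i. t i * (A *v z) $ i \<ge> 0) \<and>
            (\<Sum>j\<in>UNIV. s j * z $ j) \<le> 1}" for s t
  have "\<exists>V. finite V \<and> P s t = convex hull V" if "s \<in> S" for s t
  proof -
    have "s j = 1 \<or> s j = -1" for j
      using that by (auto simp: S_def dest: PiE_mem[of _ _ _ j])
    thus ?thesis
      using polytope_sign_pattern[where s = s and t = t and A = A] by (simp add: P_def polytope_def)
  qed
  then obtain V where V: "\<And>s t. s \<in> S \<Longrightarrow> finite (V s t)" "\<And>s t. s \<in> S \<Longrightarrow> P s t = convex hull (V s t)"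
    by metis
  have fin: "finite S" "finite S'"
    by (auto simp: S_def S'_def intro!: finite_PiE)
  define W where "W = (\<Union>s\<in>S. \<Union>t\<in>S'. V s t)"
  have "finite W"
    using fin V by (auto simp: W_def)
  \<comment> \<open>A sum of nonnegative ratios is a simple upper bound for their maximum; terms
    with \<open>g $ j = 0\<close> are 0 by the convention for division.\<close>
  define K where "K = (\<Sum>g\<in>W. \<Sum>j\<in>UNIV. \<Sum>k\<in>UNIV. \<bar>g $ k\<bar> / \<bar>g $ j\<bar>)"
  have K: "\<bar>g $ k\<bar> \<le> K * \<bar>g $ j\<bar>" if "g \<in> W" "g $ j \<noteq> 0" for g j k
  proof -
    have "\<bar>g $ k\<bar> / \<bar>g $ j\<bar> \<le> (\<Sum>k\<in>UNIV. \<bar>g $ k\<bar> / \<bar>g $ j\<bar>)"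
      by (intro member_le_sum) auto
    also have "\<dots> \<le> (\<Sum>j\<in>UNIV. \<Sum>k\<in>UNIV. \<bar>g $ k\<bar> / \<bar>g $ j\<bar>)"
      by (intro member_le_sum[of j UNIV "\<lambda>j. \<Sum>k\<in>UNIV. \<bar>g $ k\<bar> / \<bar>g $ j\<bar>"] sum_nonneg) auto
    also have "\<dots> \<le> K"
      unfolding K_def using that \<open>finite W\<close>
      by (intro member_le_sum[of g W "\<lambda>g. \<Sum>j\<in>UNIV. \<Sum>k\<in>UNIV. \<bar>g $ k\<bar> / \<bar>g $ j\<bar>"] sum_nonneg) auto
    finally show ?thesis
      using that by (simp add: divide_simps)
  qed
  have "K \<ge> 0"
    unfolding K_def by (intro sum_nonneg) auto
  moreover have "\<exists>(G :: (real^'n) set) h. finite G \<and> z = sum h G \<and>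
      (\<forall>g\<in>G. conformal (h g) z \<and> conformal (A *v h g) (A *v z) \<and>
        (\<forall>j k. h g $ j \<noteq> 0 \<longrightarrow> \<bar>h g $ k\<bar> \<le> K * \<bar>h g $ j\<bar>))" for z
  proof (cases "z = 0")
    case True
    thus ?thesis by (intro exI[of _ "{}"]) auto
  next
    case False
    define s where "s j = (if z $ j \<ge> 0 then 1 else -1 :: real)" for j
    define t where "t i = (if (A *v z) $ i \<ge> 0 then 1 else -1 :: real)" for i
    have s: "s \<in> S" "s j = 1 \<or> s j = -1" "s j * z $ j = \<bar>z $ j\<bar>" for j
      by (auto simp: S_def s_def)
    have t: "t \<in> S'" "t i = 1 \<or> t i = -1" "t i * (A *v z) $ i = \<bar>(A *v z) $ i\<bar>" for i
      by (auto simp: S'_def t_def)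
    define N where "N = (\<Sum>j\<in>UNIV. \<bar>z $ j\<bar>)"
    have "0 < norm z" using False by simp
    also have "norm z \<le> N"
      unfolding N_def by (rule norm_le_l1_cart)
    finally have "N > 0" .
    have "(1 / N) *\<^sub>R z \<in> P s t"
    proof -
      have "s j * ((1 / N) *\<^sub>R z) $ j = (1 / N) * \<bar>z $ j\<bar>" for j
        using s(3)[of j] by simp
      moreover have "t i * (A *v ((1 / N) *\<^sub>R z)) $ i = (1 / N) * \<bar>(A *v z) $ i\<bar>" for i
        using t(3)[of i] by (simp add: matrix_vector_mult_scaleR)
      ultimately show ?thesis
        using \<open>N > 0\<close> unfolding P_def
        by (simp add: sum_distrib_left[symmetric] N_def[symmetric] sum_divide_distrib[symmetric])
    qed
    then obtain u where u: "\<And>v. v \<in> V s t \<Longrightarrow> 0 \<le> u v" "(\<Sum>v\<in>V s t. u v *\<^sub>R v) = (1 / N) *\<^sub>R z"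
      using V(1)[OF s(1), of t] by (auto simp: V(2)[OF s(1)] convex_hull_finite)
    \<comment> \<open>Undoing the normalisation leaves a nonnegative multiple of a vertex, which
      lies in the same sign cone and has the same ratios between entries.\<close>
    define h where "h v = (N * u v) *\<^sub>R v" for v
    have hz: "sum h (V s t) = z"
    proof -
      have "sum h (V s t) = N *\<^sub>R (\<Sum>v\<in>V s t. u v *\<^sub>R v)"
        by (simp add: h_def scaleR_sum_right)
      thus ?thesis using u(2) \<open>N > 0\<close> by simp
    qed
    have VP: "v \<in> P s t" if "v \<in> V s t" for v
      using that by (simp add: V(2)[OF s(1)] hull_inc)
    have "conformal (h v) z \<and> conformal (A *v h v) (A *v z)" if "v \<in> V s t" for v
    proof -
      have "s j * h w $ j \<ge> 0" if "w \<in> V s t" for w j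
      proof -
        have "s j * h w $ j = (N * u w) * (s j * w $ j)"
          by (simp add: h_def)
        also have "\<dots> \<ge> 0"
          using VP[OF that] u(1)[OF that] \<open>N > 0\<close>
          by (intro mult_nonneg_nonneg[of "N * u w"]) (auto simp: P_def)
        finally show ?thesis .
      qed
      hence "min 0 (\<Sum>w\<in>V s t. h w $ j) \<le> h v $ j \<and> h v $ j \<le> max 0 (\<Sum>w\<in>V s t. h w $ j)" for j
        using V(1)[OF s(1)] that s(2)[of j] by (intro sum_same_sign_between[where s = "s j"]) auto
      moreover have "t i * (A *v h w) $ i \<ge> 0" if "w \<in> V s t" for w i
      proof -
        have "t i * (A *v h w) $ i = (N * u w) * (t i * (A *v w) $ i)"
          by (simp add: h_def matrix_vector_mult_scaleR)
        also have "\<dots> \<ge> 0"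
          using VP[OF that] u(1)[OF that] \<open>N > 0\<close>
          by (intro mult_nonneg_nonneg[of "N * u w"]) (auto simp: P_def)
        finally show ?thesis .
      qed
      hence "min 0 (\<Sum>w\<in>V s t. (A *v h w) $ i) \<le> (A *v h v) $ i \<and>
          (A *v h v) $ i \<le> max 0 (\<Sum>w\<in>V s t. (A *v h w) $ i)" for i
        using V(1)[OF s(1)] that t(2)[of i] by (intro sum_same_sign_between[where s = "t i"]) auto
      moreover have "(\<Sum>w\<in>V s t. h w $ j) = z $ j" for j
        using hz by (metis sum_component)
      moreover have "(\<Sum>w\<in>V s t. (A *v h w) $ i) = (A *v z) $ i" for i
        using hz by (metis (no_types) linear_sum[OF matrix_vector_mul_linear] sum_component)
      ultimately show ?thesis
        by (simp add: conformal_def)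
    qed
    moreover have "\<bar>h v $ k\<bar> \<le> K * \<bar>h v $ j\<bar>" if "v \<in> V s t" "h v $ j \<noteq> 0" for v j k
    proof -
      have "v \<in> W" using that(1) s(1) t(1) by (auto simp: W_def)
      hence "\<bar>v $ k\<bar> \<le> K * \<bar>v $ j\<bar>"
        using that(2) by (intro K) (auto simp: h_def)
      hence "\<bar>N * u v\<bar> * \<bar>v $ k\<bar> \<le> \<bar>N * u v\<bar> * (K * \<bar>v $ j\<bar>)"
        by (intro mult_left_mono) auto
      thus ?thesis by (simp add: h_def abs_mult mult_ac)
    qed
    ultimately show ?thesis
      using hz V(1)[OF s(1), of t] by (intro exI[of _ "V s t"] exI[of _ h]) auto
  qed
  ultimately show ?thesis by (rule that)
qed

section \<open>Existence of optimal and of nearest optimal solutions\<close>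

lemma lp_optimal_iff:
  "lp_optimal A r b d y \<longleftrightarrow>
     lp_feasible A b d y \<and> (\<forall>y'. lp_feasible A b d y' \<longrightarrow> r \<bullet> y' \<le> r \<bullet> y)"
  by (auto simp: lp_optimal_def is_arg_max_def not_less)

lemma compact_lp_feasible: "compact {y. lp_feasible A b d y}"
proof -
  have eq: "{y. lp_feasible A b d y} = cbox 0 d \<inter> {y. \<forall>i. (A *v y) $ i \<le> b $ i}"
    by (auto simp: lp_feasible_def less_eq_vec_def mem_box_cart)
  have "closed {y. \<forall>i. (A *v y) $ i \<le> b $ i}"
    unfolding matrix_vector_mul_component
    by (intro closed_Collect_all closed_Collect_le continuous_intros)
  thus ?thesis
    unfolding eq by (intro compact_Int_closed compact_cbox)
qed

lemma lp_optimal_exists: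
  assumes "lp_feasible A b d y0"
  obtains y where "lp_optimal A r b d y"
proof -
  have "\<exists>y\<in>{y. lp_feasible A b d y}. \<forall>y'\<in>{y. lp_feasible A b d y}. r \<bullet> y' \<le> r \<bullet> y"
    using assms by (intro continuous_attains_sup compact_lp_feasible continuous_intros) auto
  thus ?thesis using that by (auto simp: lp_optimal_iff)
qed

text \<open>Nearness is measured in the l1 norm because conformal pieces add up in it without
  cancellation: removing part of a piece shortens the distance by exactly its length.\<close>

lemma nearest_lp_optimal_exists:
  assumes "lp_feasible A b d y0"
  obtains y where "lp_optimal A r b d y"
    "\<And>y'. lp_optimal A r b d y' \<Longrightarrow> (\<Sum>j\<in>UNIV. \<bar>y $ j - u $ j\<bar>) \<le> (\<Sum>j\<in>UNIV. \<bar>y' $ j - u $ j\<bar>)"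
proof -
  obtain z where z: "lp_optimal A r b d z"
    using lp_optimal_exists[OF assms] .
  have eq: "{y. lp_optimal A r b d y} = {y. lp_feasible A b d y} \<inter> {y. r \<bullet> z \<le> r \<bullet> y}"
    using z by (auto simp: lp_optimal_iff intro: order_trans)
  have "compact {y. lp_optimal A r b d y}"
    unfolding eq by (intro compact_Int_closed compact_lp_feasible closed_Collect_le continuous_intros)
  hence "\<exists>y\<in>{y. lp_optimal A r b d y}. \<forall>y'\<in>{y. lp_optimal A r b d y}.
      (\<Sum>j\<in>UNIV. \<bar>y $ j - u $ j\<bar>) \<le> (\<Sum>j\<in>UNIV. \<bar>y' $ j - u $ j\<bar>)"
    using z by (intro continuous_attains_inf continuous_intros) auto
  thus ?thesis using that by auto
qed


section \<open>Steps along conformal vectors\<close>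

lemma conformalD:
  assumes "conformal h z"
  shows "h $ i > 0 \<Longrightarrow> h $ i \<le> z $ i" "h $ i < 0 \<Longrightarrow> z $ i \<le> h $ i"
  using spec[OF assms[unfolded conformal_def], of i] by (auto simp: min_def max_def split: if_splits)

text \<open>Both \<open>y - \<delta> h\<close> and \<open>x + \<delta> h\<close> stay between
  \<open>x\<close> and \<open>y\<close> in every component, so they inherit a bound that the two
  endpoints share.\<close>

lemma conformal_step_le:
  assumes "conformal h (y - x)" "x $ i \<le> c" "y $ i \<le> c" "0 \<le> \<delta>" "\<delta> \<le> 1"
  shows "y $ i - \<delta> * h $ i \<le> c" "x $ i + \<delta> * h $ i \<le> c"
proof -
  consider "h $ i = 0" | "h $ i > 0" | "h $ i < 0" by linarith
  hence "y $ i - \<delta> * h $ i \<le> c \<and> x $ i + \<delta> * h $ i \<le> c"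
  proof cases
    case 2
    hence "h $ i \<le> y $ i - x $ i" "0 \<le> \<delta> * h $ i" "\<delta> * h $ i \<le> h $ i"
      using conformalD(1)[OF assms(1)] assms(4,5) by (auto simp: mult_left_le_one_le)
    thus ?thesis using assms by linarith
  next
    case 3
    hence "h $ i \<ge> y $ i - x $ i" "0 \<ge> \<delta> * h $ i" "\<delta> * h $ i \<ge> h $ i"
      using conformalD(2)[OF assms(1)] assms(4,5) 
      by (auto simp: mult_nonneg_nonpos mult_le_cancel_right2)
    thus ?thesis using assms by linarith
  qed (use assms in auto)
  thus "y $ i - \<delta> * h $ i \<le> c" "x $ i + \<delta> * h $ i \<le> c" by auto
qed

lemma conformal_uminus:
  assumes "conformal h z"
  shows "conformal (- h) (- z)"
  unfolding conformal_def
proof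
  fix i
  have "min 0 (z $ i) \<le> h $ i" "h $ i \<le> max 0 (z $ i)"
    using assms by (auto simp: conformal_def)
  thus "min 0 ((- z) $ i) \<le> (- h) $ i \<and> (- h) $ i \<le> max 0 ((- z) $ i)"
    by (auto simp: min_def max_def split: if_splits)
qed

lemma conformal_step_ge:
  assumes "conformal h (y - x)" "c \<le> x $ i" "c \<le> y $ i" "0 \<le> \<delta>" "\<delta> \<le> 1"
  shows "c \<le> y $ i - \<delta> * h $ i" "c \<le> x $ i + \<delta> * h $ i"
  using conformal_step_le[of "- h" "- y" "- x" i "- c" \<delta>] assms
    conformal_uminus[OF assms(1)] by auto

text \<open>In each component all pieces have the sign of the total, so nothing cancels.\<close>

lemma conformal_sum_abs:
  fixes h :: "'a \<Rightarrow> real^'n"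
  assumes "\<And>g. g \<in> G \<Longrightarrow> conformal (h g) (sum h G)"
  shows "(\<Sum>g\<in>G. \<bar>h g $ i\<bar>) = \<bar>sum h G $ i\<bar>"
proof (cases "sum h G $ i \<ge> 0")
  case True
  have "h g $ i \<ge> 0" if "g \<in> G" for g
    using assms[OF that] True by (auto simp: conformal_def min_def dest: spec[of _ i])
  hence "(\<Sum>g\<in>G. \<bar>h g $ i\<bar>) = (\<Sum>g\<in>G. h g $ i)"
    by (intro sum.cong) auto
  thus ?thesis using True by simp
next
  case False
  have "h g $ i \<le> 0" if "g \<in> G" for g
    using assms[OF that] False by (auto simp: conformal_def max_def dest: spec[of _ i])
  hence "(\<Sum>g\<in>G. \<bar>h g $ i\<bar>) = (\<Sum>g\<in>G. - h g $ i)"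
    by (intro sum.cong) auto
  thus ?thesis using False by (simp add: sum_negf)
qed

lemma conformal_abs_diff:
  assumes "conformal h z" "0 \<le> \<delta>" "\<delta> \<le> 1"
  shows "\<bar>z $ i - \<delta> * h $ i\<bar> = \<bar>z $ i\<bar> - \<delta> * \<bar>h $ i\<bar>"
proof (cases "z $ i \<ge> 0")
  case True
  hence "h $ i \<ge> 0"
    using assms(1) by (auto simp: conformal_def min_def dest: spec[of _ i])
  moreover have "0 \<le> z $ i - \<delta> * h $ i"
    using conformal_step_ge(1)[of h z 0 0 i \<delta>] assms True by simp
  ultimately show ?thesis using True by simp
next
  case False
  hence "h $ i \<le> 0"
    using assms(1) by (auto simp: conformal_def max_def dest: spec[of _ i])
  moreover have "z $ i - \<delta> * h $ i \<le> 0"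
    using conformal_step_le(1)[of h z 0 i 0 \<delta>] assms False by simp
  ultimately show ?thesis using False by simp
qed

lemma lp_feasible_components:
  "lp_feasible A b d y \<longleftrightarrow>
     (\<forall>i. (A *v y) $ i \<le> b $ i) \<and> (\<forall>j. 0 \<le> y $ j) \<and> (\<forall>j. y $ j \<le> d $ j)"
  by (auto simp: lp_feasible_def less_eq_vec_def)

text \<open>A conformal direction that moves away from no active demand bound can be followed both from
  \<open>y\<close> towards \<open>u\<close> and from \<open>u\<close> towards \<open>y\<close>. Hence it has reward 0, and a short step brings \<open>y\<close>
  nearer to \<open>u\<close>.\<close>

lemma nearest_lp_optimal_direction:
  assumes u: "lp_optimal A r b d u" and y: "lp_optimal A r b D y"
    and nearest: "\<And>y'. lp_optimal A r b D y' \<Longrightarrow>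
      (\<Sum>j\<in>UNIV. \<bar>y $ j - u $ j\<bar>) \<le> (\<Sum>j\<in>UNIV. \<bar>y' $ j - u $ j\<bar>)"
    and h: "conformal h (y - u)" "conformal (A *v h) (A *v (y - u))" "h \<noteq> 0"
  shows "\<exists>j. h $ j \<noteq> 0 \<and> (y $ j = D $ j \<and> D $ j < u $ j \<or> u $ j = d $ j \<and> d $ j < y $ j)"
proof (rule ccontr)
  assume contra: "\<not> ?thesis"
  have uf: "(A *v u) $ i \<le> b $ i" "0 \<le> u $ j" "u $ j \<le> d $ j"
    and yf: "(A *v y) $ i \<le> b $ i" "0 \<le> y $ j" "y $ j \<le> D $ j" for i j
    using u y by (auto simp: lp_optimal_iff lp_feasible_components)
  \<comment> \<open>Only the demand bounds call for a short step, since they differ for the two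
    programs (\<open>D\<close> for \<open>y\<close>, \<open>d\<close> for \<open>u\<close>).
    Resource and sign constraints are common to both, and conformality takes care of them.\<close>
  have ev: "\<forall>\<^sub>F \<delta> in at_right 0. y $ j - \<delta> * h $ j \<le> D $ j \<and> u $ j + \<delta> * h $ j \<le> d $ j" for j
  proof (intro eventually_conj)
    show "\<forall>\<^sub>F \<delta> in at_right 0. y $ j - \<delta> * h $ j \<le> D $ j"
    proof (cases "h $ j < 0 \<and> y $ j < D $ j")
      case True
      have "((\<lambda>\<delta>. y $ j - \<delta> * h $ j) \<longlongrightarrow> y $ j - 0 * h $ j) (at_right 0)"
        by (intro tendsto_intros)
      hence "\<forall>\<^sub>F \<delta> in at_right 0. y $ j - \<delta> * h $ j < D $ j"
        using True by (intro order_tendstoD) auto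
      thus ?thesis by eventually_elim simp
    next
      case False
      \<comment> \<open>Otherwise \<open>y $ j = D $ j\<close>, and conformality gives
        \<open>D $ j < u $ j\<close>, which \<open>contra\<close> excludes.\<close>
      have "h $ j \<ge> 0"
      proof (rule ccontr)
        assume neg: "\<not> h $ j \<ge> 0"
        hence "h $ j \<noteq> 0" "D $ j < u $ j" "y $ j = D $ j"
          using conformalD(2)[OF h(1), of j] False yf(3)[of j] by auto
        with contra show False by blast
      qed
      hence "y $ j - \<delta> * h $ j \<le> D $ j" if "\<delta> > 0" for \<delta>
        using yf(3)[of j] mult_nonneg_nonneg[of \<delta> "h $ j"] that by linarith
      thus ?thesis
        by (auto simp: eventually_at_filter)
    qed
    show "\<forall>\<^sub>F \<delta> in at_right 0. u $ j + \<delta> * h $ j \<le> d $ j"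
    proof (cases "h $ j > 0 \<and> u $ j < d $ j")
      case True
      have "((\<lambda>\<delta>. u $ j + \<delta> * h $ j) \<longlongrightarrow> u $ j + 0 * h $ j) (at_right 0)"
        by (intro tendsto_intros)
      hence "\<forall>\<^sub>F \<delta> in at_right 0. u $ j + \<delta> * h $ j < d $ j"
        using True by (intro order_tendstoD) auto
      thus ?thesis by eventually_elim simp
    next
      case False
      have "h $ j \<le> 0"
      proof (rule ccontr)
        assume pos: "\<not> h $ j \<le> 0"
        hence "h $ j \<noteq> 0" "d $ j < y $ j" "u $ j = d $ j"
          using conformalD(1)[OF h(1), of j] False uf(3)[of j] by auto
        with contra show False by blast
      qed
      hence "u $ j + \<delta> * h $ j \<le> d $ j" if "\<delta> > 0" for \<delta>
        using uf(3)[of j] mult_nonneg_nonpos[of \<delta> "h $ j"] that by linarith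
      thus ?thesis
        by (auto simp: eventually_at_filter)
    qed
  qed
  have "\<forall>\<^sub>F \<delta> in at_right 0. (\<forall>j. y $ j - \<delta> * h $ j \<le> D $ j \<and> u $ j + \<delta> * h $ j \<le> d $ j) \<and>
      (\<delta> :: real) \<in> {0<..<1}"
    by (intro eventually_conj eventually_all_finite ev eventually_at_right_real) auto
  from eventually_happens'[OF trivial_limit_at_right_real this]
  obtain \<delta> where \<delta>: "\<And>j. y $ j - \<delta> * h $ j \<le> D $ j" "\<And>j. u $ j + \<delta> * h $ j \<le> d $ j"
      "0 < \<delta>" "\<delta> < 1"
    by auto
  have cA: "conformal (A *v h) (A *v y - A *v u)"
    using h(2) by (simp add: matrix_vector_mult_diff_distrib)
  have y': "lp_feasible A b D (y - \<delta> *\<^sub>R h)"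
    using \<delta> yf uf conformal_step_le(1)[OF cA, of _ _ \<delta>] conformal_step_ge(1)[OF h(1), of 0 _ \<delta>]
    by (simp add: lp_feasible_components matrix_vector_mult_diff_distrib matrix_vector_mult_scaleR)
  have u': "lp_feasible A b d (u + \<delta> *\<^sub>R h)"
    using \<delta> yf uf conformal_step_le(2)[OF cA, of _ _ \<delta>] conformal_step_ge(2)[OF h(1), of 0 _ \<delta>]
    by (simp add: lp_feasible_components matrix_vector_right_distrib matrix_vector_mult_scaleR)
  \<comment> \<open>Optimality of \<open>y\<close> gives \<open>r \<bullet> h \<ge> 0\<close>,
    optimality of \<open>u\<close> gives \<open>r \<bullet> h \<le> 0\<close>.\<close>
  have "r \<bullet> (y - \<delta> *\<^sub>R h) \<le> r \<bullet> y" "r \<bullet> (u + \<delta> *\<^sub>R h) \<le> r \<bullet> u"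
    using u y u' y' by (auto simp: lp_optimal_iff)
  hence "r \<bullet> h = 0"
    using \<delta>(3) by (simp add: inner_diff_right inner_add_right zero_le_mult_iff mult_le_0_iff)
  hence "lp_optimal A r b D (y - \<delta> *\<^sub>R h)"
    using y y' by (simp add: lp_optimal_iff inner_diff_right)
  from nearest[OF this]
  have "(\<Sum>j\<in>UNIV. \<bar>(y - u) $ j\<bar>) \<le> (\<Sum>j\<in>UNIV. \<bar>(y - u) $ j - \<delta> * h $ j\<bar>)"
    by (simp add: algebra_simps)
  also have "\<dots> = (\<Sum>j\<in>UNIV. \<bar>(y - u) $ j\<bar>) - \<delta> * (\<Sum>j\<in>UNIV. \<bar>h $ j\<bar>)"
    using \<delta> by (simp only: conformal_abs_diff[OF h(1)] sum_subtractf sum_distrib_left less_imp_le)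
  finally have "(\<Sum>j\<in>UNIV. \<bar>h $ j\<bar>) \<le> 0"
    using \<delta>(3) by (simp add: mult_le_0_iff)
  hence "norm h \<le> 0"
    using norm_le_l1_cart[of h] by linarith
  hence "h = 0" by simp
  thus False using h(3) by contradiction
qed

lemma matrix_vector_mult_nonneg:
  fixes A :: "real^'n^'m"
  assumes "\<And>i j. A $ i $ j \<ge> 0" "\<And>j. y $ j \<ge> 0"
  shows "(A *v y) $ i \<ge> 0"
  unfolding matrix_vector_mult_def using assms by (auto intro!: sum_nonneg)

text \<open>Take \<open>y\<close> nearest to \<open>u\<close> and decompose \<open>y - u\<close>.
  Each nonzero piece moves some coordinate of \<open>J\<close>, where an active demand bound of one
  program separates the two solutions, and the bounded ratios control the whole piece by this
  coordinate. On \<open>J\<close> the solutions differ by at most as much as the demands, and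
  conformality lets the pieces be summed.\<close>

proposition lp_optimal_stable:
  fixes A :: "real^'n^'m"
  assumes A: "\<And>i j. A $ i $ j \<ge> 0"
  obtains K where "K \<ge> 0"
    "\<And>r b d D u. 0 \<le> D \<Longrightarrow> lp_optimal A r b d u \<Longrightarrow>
      \<exists>y. lp_optimal A r b D y \<and> (\<forall>j. \<bar>y $ j - u $ j\<bar> \<le> K * (\<Sum>i\<in>UNIV. \<bar>d $ i - D $ i\<bar>))"
proof -
  obtain K where K: "K \<ge> 0"
    "\<And>z. \<exists>(G :: (real^'n) set) h. finite G \<and> z = sum h G \<and>
      (\<forall>g\<in>G. conformal (h g) z \<and> conformal (A *v h g) (A *v z) \<and>
        (\<forall>j k. h g $ j \<noteq> 0 \<longrightarrow> \<bar>h g $ k\<bar> \<le> K * \<bar>h g $ j\<bar>))"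
    using conformal_decomposition[of A] by blast
  have "\<exists>y. lp_optimal A r b D y \<and> (\<forall>j. \<bar>y $ j - u $ j\<bar> \<le> K * (\<Sum>i\<in>UNIV. \<bar>d $ i - D $ i\<bar>))"
    if D: "0 \<le> D" and u: "lp_optimal A r b d u" for r b d D u
  proof -
    have uf: "(A *v u) $ i \<le> b $ i" "0 \<le> u $ j" "u $ j \<le> d $ j" for i j
      using u by (auto simp: lp_optimal_iff lp_feasible_components)
    have "lp_feasible A b D 0"
      using D uf(1) matrix_vector_mult_nonneg[of A u, OF A uf(2)]
      by (auto simp: lp_feasible_components less_eq_vec_def intro: order_trans)
    then obtain y where y: "lp_optimal A r b D y"
      and nearest: "\<And>y'. lp_optimal A r b D y' \<Longrightarrow>
        (\<Sum>j\<in>UNIV. \<bar>y $ j - u $ j\<bar>) \<le> (\<Sum>j\<in>UNIV. \<bar>y' $ j - u $ j\<bar>)"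
      using nearest_lp_optimal_exists[of A b D 0 r u] by blast
    have yf: "y $ j \<le> D $ j" for j
      using y by (auto simp: lp_optimal_iff lp_feasible_components)
    obtain G :: "(real^'n) set" and h where G: "finite G" "y - u = sum h G"
      "\<And>g. g \<in> G \<Longrightarrow> conformal (h g) (y - u)"
      "\<And>g. g \<in> G \<Longrightarrow> conformal (A *v h g) (A *v (y - u))"
      "\<And>g j k. g \<in> G \<Longrightarrow> h g $ j \<noteq> 0 \<Longrightarrow> \<bar>h g $ k\<bar> \<le> K * \<bar>h g $ j\<bar>"
      using K(2)[of "y - u"] by blast
    define J where "J = {j. y $ j = D $ j \<and> D $ j < u $ j \<or> u $ j = d $ j \<and> d $ j < y $ j}"
    have sum_abs: "(\<Sum>g\<in>G. \<bar>h g $ j\<bar>) = \<bar>y $ j - u $ j\<bar>" for j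
      using conformal_sum_abs[of G h j] G(3) by (simp flip: G(2))
    have "\<bar>y $ j - u $ j\<bar> \<le> K * (\<Sum>i\<in>UNIV. \<bar>d $ i - D $ i\<bar>)" for j
    proof -
      have *: "\<bar>h g $ j\<bar> \<le> (\<Sum>k\<in>J. K * \<bar>h g $ k\<bar>)" if "g \<in> G" for g
      proof (cases "h g = 0")
        case False
        have "\<exists>k. h g $ k \<noteq> 0 \<and> (y $ k = D $ k \<and> D $ k < u $ k \<or> u $ k = d $ k \<and> d $ k < y $ k)"
          by (rule nearest_lp_optimal_direction[OF u y]) (use nearest G(3,4)[OF that] False in auto)
        then obtain k where k: "k \<in> J" "h g $ k \<noteq> 0"
          by (auto simp: J_def)
        have "\<bar>h g $ j\<bar> \<le> K * \<bar>h g $ k\<bar>"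
          using G(5)[OF that k(2)] .
        also have "\<dots> \<le> (\<Sum>k\<in>J. K * \<bar>h g $ k\<bar>)"
          using k(1) K(1) by (intro member_le_sum) auto
        finally show ?thesis .
      qed simp
      have "\<bar>y $ j - u $ j\<bar> \<le> (\<Sum>g\<in>G. \<Sum>k\<in>J. K * \<bar>h g $ k\<bar>)"
        unfolding sum_abs[symmetric] by (intro sum_mono *)
      also have "\<dots> = K * (\<Sum>k\<in>J. \<bar>y $ k - u $ k\<bar>)"
        unfolding sum_abs[symmetric] by (subst sum.swap) (simp add: sum_distrib_left)
      \<comment> \<open>On \<open>J\<close> either \<open>y $ k = D $ k < u $ k \<le> d $ k\<close>
        or \<open>d $ k = u $ k < y $ k \<le> D $ k\<close>.\<close>
      also have "\<dots> \<le> K * (\<Sum>k\<in>J. \<bar>d $ k - D $ k\<bar>)"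
      proof (intro mult_left_mono sum_mono K)
        fix k assume "k \<in> J"
        thus "\<bar>y $ k - u $ k\<bar> \<le> \<bar>d $ k - D $ k\<bar>"
          using uf(3)[of k] yf[of k] by (auto simp: J_def)
      qed
      also have "\<dots> \<le> K * (\<Sum>k\<in>UNIV. \<bar>d $ k - D $ k\<bar>)"
        using K(1) by (intro mult_left_mono sum_mono2) auto
      finally show ?thesis .
    qed
    thus ?thesis using y by blast
  qed
  thus ?thesis using that K(1) by blast
qed

section \<open>Values of the linear program\<close>

definition lp_value :: "real^'n^'m \<Rightarrow> real^'n \<Rightarrow> real^'m \<Rightarrow> real^'n \<Rightarrow> real" where
  "lp_value A r b d = (SUP y \<in> {y. lp_feasible A b d y}. r \<bullet> y)"

lemma lp_value_eq:
  assumes "lp_optimal A r b d y"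
  shows "lp_value A r b d = r \<bullet> y"
  unfolding lp_value_def using assms
  by (intro cSup_eq_maximum) (auto simp: lp_optimal_iff)

lemma lp_value_ge:
  assumes "lp_feasible A b d y"
  shows "r \<bullet> y \<le> lp_value A r b d"
proof -
  obtain y' where "lp_optimal A r b d y'"
    using lp_optimal_exists[OF assms] .
  with assms show ?thesis
    by (auto simp: lp_value_eq lp_optimal_iff)
qed

text \<open>Adding back one unit of type \<open>j\<close> turns a competitor of the reduced program
  into one of the original program; both objectives shift by \<open>r $ j\<close>.\<close>

lemma lp_optimal_accept:
  fixes A :: "real^'n^'m"
  assumes "lp_optimal A r b d y" "y $ j \<ge> 1"
  shows "lp_optimal A r (b - column j A) (d - axis j 1) (y - axis j 1)"
proof -
  have ax: "axis j 1 $ k = (if k = j then 1 else 0 :: real)" for k :: 'n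
    by (simp add: axis_def)
  have "lp_feasible A (b - column j A) (d - axis j 1) (y - axis j 1)"
    using assms by (auto simp: lp_optimal_iff lp_feasible_components matrix_vector_mult_diff_distrib
        matrix_vector_mult_basis ax)
  moreover have "r \<bullet> y' \<le> r \<bullet> (y - axis j 1)"
    if "lp_feasible A (b - column j A) (d - axis j 1) y'" for y'
  proof -
    have "0 \<le> y' $ k + axis j 1 $ k \<and> y' $ k + axis j 1 $ k \<le> d $ k" for k
      using that by (auto simp: lp_feasible_components ax le_diff_eq dest!: spec[of _ k] split: if_splits)
    hence "lp_feasible A b d (y' + axis j 1)"
      using that by (simp add: lp_feasible_components matrix_vector_right_distrib
          matrix_vector_mult_basis le_diff_eq)
    hence "r \<bullet> (y' + axis j 1) \<le> r \<bullet> y"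
      using assms by (auto simp: lp_optimal_iff)
    thus ?thesis by (simp add: inner_diff_right inner_add_right)
  qed
  ultimately show ?thesis by (simp add: lp_optimal_iff)
qed

text \<open>Less demand shrinks the feasible set, and \<open>y\<close> remains in it because it
  leaves a unit of type \<open>j\<close> unserved.\<close>

lemma lp_optimal_reject:
  fixes A :: "real^'n^'m"
  assumes "lp_optimal A r b d y" "y $ j \<le> d $ j - 1"
  shows "lp_optimal A r b (d - axis j 1) y"
proof -
  have "lp_feasible A b (d - axis j 1) y"
    using assms by (auto simp: lp_optimal_iff lp_feasible_components axis_def)
  moreover have "lp_feasible A b d y'" if "lp_feasible A b (d - axis j 1) y'" for y'
  proof -
    have "y' $ k \<le> d $ k" for k
      using that by (auto simp: lp_feasible_components axis_def dest!: spec[of _ k] split: if_splits)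
    thus ?thesis using that by (auto simp: lp_feasible_components)
  qed
  ultimately show ?thesis
    using assms by (simp add: lp_optimal_iff)
qed

text \<open>Cutting an optimum for \<open>D\<close> down to \<open>d\<close> respects the resources
  as \<open>A\<close> is nonnegative, and costs at most \<open>r $ j\<close> per unit cut.\<close>

lemma lp_value_demand_le:
  fixes A :: "real^'n^'m"
  assumes A: "\<And>i j. A $ i $ j \<ge> 0" and r: "\<And>j. r $ j \<ge> 0"
    and "0 \<le> b" "0 \<le> D" "0 \<le> d"
  shows "lp_value A r b D \<le> lp_value A r b d + (\<Sum>j\<in>UNIV. r $ j * \<bar>d $ j - D $ j\<bar>)"
proof -
  have "lp_feasible A b D 0"
    using assms by (simp add: lp_feasible_def)
  then obtain y where y: "lp_optimal A r b D y"
    using lp_optimal_exists by blast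
  define y' where "y' = (\<chi> j. min (y $ j) (d $ j))"
  have yf: "(A *v y) $ i \<le> b $ i" "0 \<le> y $ j" "y $ j \<le> D $ j" for i j
    using y by (auto simp: lp_optimal_iff lp_feasible_components)
  have "(A *v (y - y')) $ i \<ge> 0" for i
    by (intro matrix_vector_mult_nonneg A) (simp add: y'_def)
  hence "(A *v y') $ i \<le> b $ i" for i
    using yf(1)[of i] by (auto simp: matrix_vector_mult_diff_distrib intro: order_trans)
  hence "lp_feasible A b d y'"
    using yf \<open>0 \<le> d\<close> by (simp add: lp_feasible_components y'_def less_eq_vec_def)
  hence "r \<bullet> y' \<le> lp_value A r b d"
    by (rule lp_value_ge)
  moreover have "r \<bullet> y \<le> r \<bullet> y' + (\<Sum>j\<in>UNIV. r $ j * \<bar>d $ j - D $ j\<bar>)"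
  proof -
    have "r $ j * y $ j \<le> r $ j * y' $ j + r $ j * \<bar>d $ j - D $ j\<bar>" for j
      using r[of j] yf(3)[of j] unfolding distrib_left[symmetric]
      by (intro mult_left_mono) (auto simp: y'_def min_def)
    thus ?thesis
      by (simp add: inner_vec_def sum.distrib[symmetric] sum_mono)
  qed
  ultimately show ?thesis
    using lp_value_eq[OF y] by simp
qed

lemma lp_value_le_demand:
  fixes A :: "real^'n^'m"
  assumes r: "\<And>j. r $ j \<ge> 0" and "0 \<le> b" "0 \<le> D" "\<And>j. D $ j \<le> c"
  shows "lp_value A r b D \<le> (\<Sum>j\<in>UNIV. r $ j) * c"
proof -
  have "lp_feasible A b D 0"
    using assms by (simp add: lp_feasible_def)
  then obtain y where y: "lp_optimal A r b D y"
    using lp_optimal_exists by blast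
  hence "y $ j \<le> c" for j
    using assms(4)[of j] by (auto simp: lp_optimal_iff lp_feasible_components dest!: spec[of _ j])
  hence "r \<bullet> y \<le> (\<Sum>j\<in>UNIV. r $ j * c)"
    using r by (auto simp: inner_vec_def intro!: sum_mono mult_left_mono)
  thus ?thesis
    using lp_value_eq[OF y] by (simp add: sum_distrib_right)
qed

section \<open>Sample paths\<close>

text \<open>Realised demand from period \<open>k + 1\<close> on: position \<open>k\<close> of
  \<open>\<omega>\<close> is the arrival of period \<open>k + 1\<close>, so \<open>k\<close> counts
  the periods that are over.\<close>

definition demand_from :: "nat \<Rightarrow> 'n list \<Rightarrow> real^'n::finite" where
  "demand_from k \<omega> = (\<chi> j. real (count_list (drop k \<omega>) j))"

lemma demand_from_nonneg: "0 \<le> demand_from k \<omega>"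
  by (simp add: demand_from_def less_eq_vec_def)

lemma demand_from_Suc:
  assumes "k < length \<omega>"
  shows "demand_from k \<omega> = demand_from (Suc k) \<omega> + axis (\<omega> ! k) 1"
  using assms by (simp add: demand_from_def vec_eq_iff axis_def Cons_nth_drop_Suc[symmetric])

lemma demand_from_antimono:
  assumes "k \<le> l"
  shows "demand_from l \<omega> $ j \<le> demand_from k \<omega> $ j"
proof -
  have "drop k \<omega> = take (l - k) (drop k \<omega>) @ drop l \<omega>"
    using assms by (metis append_take_drop_id drop_drop le_add_diff_inverse2)
  hence "count_list (drop l \<omega>) j \<le> count_list (drop k \<omega>) j"
    by (metis count_list_append le_add2)
  thus ?thesis by (simp add: demand_from_def)
qed

lemma demand_from_le: "demand_from k \<omega> $ j \<le> real (length \<omega>)"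
  using count_le_length[of "drop k \<omega>" j] by (simp add: demand_from_def)

lemma demand_from_length [simp]: "demand_from (length \<omega>) \<omega> = 0"
  by (simp add: demand_from_def vec_eq_iff)

lemma inventory_take:
  fixes A :: "real^'n::finite^'m::finite"
  assumes "k \<le> length \<omega>"
  shows "inventory A \<rho> T \<pi> (take k \<omega>) = real T *\<^sub>R \<rho> -
    (\<Sum>s<k. if \<pi> (take s \<omega>) (\<omega> ! s) then column (\<omega> ! s) A else 0)"
proof -
  have "(\<Sum>s<k. if \<pi> (take s (take k \<omega>)) (take k \<omega> ! s) then column (take k \<omega> ! s) A else 0) =
      (\<Sum>s<k. if \<pi> (take s \<omega>) (\<omega> ! s) then column (\<omega> ! s) A else 0)"
    by (intro sum.cong) (auto simp: min_def)
  thus ?thesis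
    using assms by (simp add: inventory_def min_absorb2 del: take_take)
qed

lemma inventory_nonneg:
  assumes "feasible_policy A \<rho> T \<pi>" "0 \<le> \<rho>" "length \<omega> = T" "k \<le> T"
  shows "0 \<le> inventory A \<rho> T \<pi> (take k \<omega>)"
  using assms(4)
proof (induction k)
  case 0
  thus ?case
    using assms(2) by (auto simp: inventory_def less_eq_vec_def)
next
  case (Suc k)
  have "column (\<omega> ! k) A \<le> inventory A \<rho> T \<pi> (take k \<omega>)" if "\<pi> (take k \<omega>) (\<omega> ! k)"
    using that assms(1,3) Suc.prems unfolding feasible_policy_def by simp
  thus ?case
    using Suc assms(3) by (auto simp: inventory_take less_eq_vec_def algebra_simps)
qed

text \<open>The numbers of accepted arrivals per type form a feasible solution of the program with
  the realised demand.\<close>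

lemma total_reward_le_lp_value:
  fixes A :: "real^'n::finite^'m::finite"
  assumes "feasible_policy A \<rho> T \<pi>" "0 \<le> \<rho>" "length \<omega> = T"
  shows "total_reward r \<pi> \<omega> \<le> lp_value A r (real T *\<^sub>R \<rho>) (demand_from 0 \<omega>)"
proof -
  define y :: "real^'n" where "y = (\<Sum>s<T. if \<pi> (take s \<omega>) (\<omega> ! s) then axis (\<omega> ! s) 1 else 0)"
  have "A *v y = (\<Sum>s<T. if \<pi> (take s \<omega>) (\<omega> ! s) then column (\<omega> ! s) A else 0)"
    unfolding y_def linear_sum[OF matrix_vector_mul_linear]
    by (intro sum.cong) (auto simp: matrix_vector_mult_basis)
  hence "real T *\<^sub>R \<rho> - A *v y = inventory A \<rho> T \<pi> \<omega>"
    using assms(3) by (simp add: inventory_def)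
  hence "0 \<le> real T *\<^sub>R \<rho> - A *v y"
    using inventory_nonneg[OF assms, of T] assms(3) by simp
  moreover have "0 \<le> y"
    unfolding y_def less_eq_vec_def by (auto simp: axis_def intro!: sum_nonneg)
  moreover have "y $ j \<le> demand_from 0 \<omega> $ j" for j
  proof -
    have "y $ j \<le> (\<Sum>s<T. axis (\<omega> ! s) 1 $ j)"
      unfolding y_def sum_component by (intro sum_mono) (auto simp: axis_def)
    also have "\<dots> = (\<Sum>s<T. demand_from s \<omega> $ j - demand_from (Suc s) \<omega> $ j)"
      using assms(3) by (intro sum.cong) (auto simp: demand_from_Suc)
    also have "\<dots> = demand_from 0 \<omega> $ j"
      using assms(3) by (subst sum_lessThan_telescope') auto
    finally show ?thesis .
  qed
  ultimately have "lp_feasible A (real T *\<^sub>R \<rho>) (demand_from 0 \<omega>) y"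
    by (simp add: lp_feasible_def less_eq_vec_def)
  moreover have "r \<bullet> y = total_reward r \<pi> \<omega>"
    unfolding y_def total_reward_def inner_sum_right assms(3)
    by (intro sum.cong) (auto simp: inner_axis)
  ultimately show ?thesis
    using lp_value_ge[of A _ _ y r] by simp
qed

section \<open>The dynamics of AIR-KP\<close>

text \<open>The last clause keeps the unused part of the plan of type \<open>j\<close> below \<open>1 + \<bar>d $ j\<bar>\<close>, the
  deviation of the remaining planned demand from 0 at the end of the horizon.\<close>

definition airkp_inv :: "real^'n^'m \<Rightarrow> ('m::finite, 'n::finite) airkp_state \<Rightarrow> bool" where
  "airkp_inv A = (\<lambda>(b, u, d). 0 \<le> u \<and> A *v u \<le> b \<and>
     (\<forall>j. u $ j \<le> 1 \<or> 2 * u $ j \<le> 1 + d $ j \<or> u $ j \<le> d $ j))"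

lemma airkp_inv_inventory_nonneg:
  fixes A :: "real^'n::finite^'m::finite"
  assumes "\<And>i j. A $ i $ j \<ge> 0" "airkp_inv A (b, u, d)"
  shows "0 \<le> b"
  using assms matrix_vector_mult_nonneg[of A u]
  by (auto simp: airkp_inv_def less_eq_vec_def intro: order_trans[of _ "(A *v u) $ _"])

text \<open>Since \<open>A *v u \<le> b\<close> with nonnegative entries, more than one planned unit
  of type \<open>j\<close> already leaves room for \<open>column j A\<close>.\<close>

lemma airkp_accepts_iff:
  fixes A :: "real^'n::finite^'m::finite"
  assumes A: "\<And>i j. A $ i $ j \<ge> 0" and inv: "airkp_inv A (b, u, d)"
  shows "airkp_accepts A (b, u, d) j \<longleftrightarrow> u $ j > 1 \<and> u $ j \<ge> d $ j - u $ j"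
proof -
  have "column j A $ i \<le> b $ i" if "u $ j > 1" for i
  proof -
    have "A $ i $ j \<le> A $ i $ j * u $ j"
      using A[of i j] that by (intro mult_le_cancel_left1[THEN iffD2]) auto
    also have "\<dots> \<le> (\<Sum>j\<in>UNIV. A $ i $ j * u $ j)"
      using A inv by (intro member_le_sum) (auto simp: airkp_inv_def less_eq_vec_def)
    also have "\<dots> = (A *v u) $ i"
      by (simp add: matrix_vector_mult_def)
    also have "\<dots> \<le> b $ i"
      using inv by (auto simp: airkp_inv_def less_eq_vec_def)
    finally show ?thesis by (simp add: column_def)
  qed
  thus ?thesis by (auto simp: airkp_accepts_def less_eq_vec_def)
qed

text \<open>An acceptance lowers \<open>u $ j\<close> and \<open>d $ j\<close> both by 1, which
  keeps each of the three clauses. A rejection lowers only \<open>d $ j\<close>, and the reason for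
  rejecting supplies a clause.\<close>

lemma airkp_inv_update:
  fixes A :: "real^'n::finite^'m::finite"
  assumes A: "\<And>i j. A $ i $ j \<ge> 0" and inv: "airkp_inv A S"
  shows "airkp_inv A (airkp_update A S j)"
proof -
  obtain b u d where S: "S = (b, u, d)" by (cases S)
  have ax: "axis j 1 $ k = (if k = j then 1 else 0 :: real)" for k :: 'n
    by (simp add: axis_def)
  have inv': "0 \<le> u $ k" "(A *v u) $ i \<le> b $ i"
    "u $ k \<le> 1 \<or> 2 * u $ k \<le> 1 + d $ k \<or> u $ k \<le> d $ k" for k i
    using inv by (auto simp: S airkp_inv_def less_eq_vec_def)
  show ?thesis
  proof (cases "airkp_accepts A (b, u, d) j")
    case True
    hence "u $ j > 1" by (simp add: airkp_accepts_def)
    hence "0 \<le> u $ k - axis j 1 $ k" for k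
      using inv'(1)[of k] by (simp add: ax)
    moreover have "u $ k - axis j 1 $ k \<le> 1 \<or>
        2 * (u $ k - axis j 1 $ k) \<le> 1 + (d $ k - axis j 1 $ k) \<or>
        u $ k - axis j 1 $ k \<le> d $ k - axis j 1 $ k" for k
      using inv'(3)[of k] by (auto simp: ax)
    ultimately show ?thesis
      using True inv'(2) unfolding S airkp_update_def airkp_inv_def
      by (simp add: less_eq_vec_def matrix_vector_mult_diff_distrib matrix_vector_mult_basis)
  next
    case False
    \<comment> \<open>Either \<open>u $ j \<le> 1\<close> persists, or
      \<open>2 * u $ j < d $ j\<close> becomes the middle clause once \<open>d $ j\<close> has
      dropped by 1.\<close>
    hence rej: "u $ j \<le> 1 \<or> 2 * u $ j < d $ j"
      using airkp_accepts_iff[OF A, of b u d j] inv by (auto simp: S)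
    have "u $ k \<le> 1 \<or> 2 * u $ k \<le> 1 + (d $ k - axis j 1 $ k) \<or> u $ k \<le> d $ k - axis j 1 $ k" for k
      using rej inv'(3)[of k] by (auto simp: ax)
    thus ?thesis
      using False inv' unfolding S airkp_update_def airkp_inv_def
      by (simp add: less_eq_vec_def)
  qed
qed

section \<open>AIR-KP along a fixed sample path\<close>

locale airkp =
  fixes A :: "real^'n::finite^'m::finite" and r :: "real^'n" and \<rho> :: "real^'m"
    and p :: "'n pmf" and sol :: "('m, 'n) solver" and R :: "nat set" and T :: nat
  assumes A_nonneg: "\<And>i j. A $ i $ j \<ge> 0" and r_nonneg: "\<And>j. r $ j \<ge> 0"
    and rho_nonneg: "0 \<le> \<rho>" and solver: "lp_solver A r sol" and first: "1 \<in> R"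
begin

definition start :: "'n list \<Rightarrow> nat \<Rightarrow> ('m, 'n) airkp_state" where
  "start \<omega> k = airkp_state A \<rho> p sol R T \<omega> k"

text \<open>The decision in period \<open>k + 1\<close> is taken on this state;
  \<open>start \<omega> k\<close> is the one before a possible re-solving.\<close>

definition resolved :: "'n list \<Rightarrow> nat \<Rightarrow> ('m, 'n) airkp_state" where
  "resolved \<omega> k = airkp_resolve p sol R T (take k \<omega>) (start \<omega> k)"

definition stock :: "'n list \<Rightarrow> nat \<Rightarrow> real^'m" where
  "stock \<omega> k = fst (start \<omega> k)"

definition plan :: "'n list \<Rightarrow> nat \<Rightarrow> real^'n" where
  "plan \<omega> k = fst (snd (resolved \<omega> k))"

definition planned_demand :: "'n list \<Rightarrow> nat \<Rightarrow> real^'n" where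
  "planned_demand \<omega> k = snd (snd (resolved \<omega> k))"

definition accepted :: "'n list \<Rightarrow> nat \<Rightarrow> bool" where
  "accepted \<omega> k = airkp_accepts A (resolved \<omega> k) (\<omega> ! k)"

definition gain :: "'n list \<Rightarrow> nat \<Rightarrow> real" where
  "gain \<omega> k = (if accepted \<omega> k then r $ (\<omega> ! k) else 0)"

definition mean_demand :: "nat \<Rightarrow> real^'n" where
  "mean_demand k = real (T - k) *\<^sub>R (\<chi> j. pmf p j)"

lemma mean_demand_nonneg: "0 \<le> mean_demand k"
  by (auto simp: mean_demand_def less_eq_vec_def)

lemma resolved_eq: "resolved \<omega> k = (stock \<omega> k, plan \<omega> k, planned_demand \<omega> k)"
  by (cases "start \<omega> k")
     (auto simp: stock_def plan_def planned_demand_def resolved_def airkp_resolve_def Let_def)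

lemma start_0: "start \<omega> 0 = (real T *\<^sub>R \<rho>, 0, 0)"
  by (simp add: start_def)

lemma start_Suc:
  "start \<omega> (Suc k) =
     (if accepted \<omega> k
      then (stock \<omega> k - column (\<omega> ! k) A, plan \<omega> k - axis (\<omega> ! k) 1, planned_demand \<omega> k - axis (\<omega> ! k) 1)
      else (stock \<omega> k, plan \<omega> k, planned_demand \<omega> k - axis (\<omega> ! k) 1))"
proof -
  have "start \<omega> (Suc k) = airkp_update A (resolved \<omega> k) (\<omega> ! k)"
    by (simp add: start_def resolved_def)
  thus ?thesis
    by (simp add: airkp_update_def accepted_def resolved_eq)
qed

lemma resolved_at:
  assumes "Suc k \<in> R" "k < T" "k \<le> length \<omega>"
  shows "planned_demand \<omega> k = mean_demand k" "plan \<omega> k = sol (take k \<omega>) (stock \<omega> k) (mean_demand k)"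
  using assms by (cases "start \<omega> k"; auto simp: plan_def planned_demand_def stock_def resolved_def
      airkp_resolve_def Let_def mean_demand_def min_def)+

lemma not_resolved_at:
  assumes "Suc k \<notin> R" "k \<le> length \<omega>"
  shows "resolved \<omega> k = start \<omega> k"
  using assms by (cases "start \<omega> k") (auto simp: resolved_def airkp_resolve_def min_def)

lemma airkp_inv_resolve:
  assumes "airkp_inv A S"
  shows "airkp_inv A (airkp_resolve p sol R T h S)"
proof -
  obtain b u d where S: "S = (b, u, d)" by (cases S)
  define d' where "d' = real (T - (length h + 1) + 1) *\<^sub>R (\<chi> j. pmf p j)"
  have "0 \<le> d'"
    by (auto simp: d'_def less_eq_vec_def)
  moreover have "0 \<le> b"
    using airkp_inv_inventory_nonneg[OF A_nonneg] assms by (auto simp: S)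
  ultimately have "lp_optimal A r b d' (sol h b d')"
    using solver by (auto simp: lp_solver_def)
  hence "airkp_inv A (b, sol h b d', d')"
    by (auto simp: airkp_inv_def lp_optimal_iff lp_feasible_def less_eq_vec_def)
  thus ?thesis
    using assms by (simp add: S airkp_resolve_def Let_def d'_def)
qed

lemma airkp_inv_start: "airkp_inv A (start \<omega> k)"
proof (induction k)
  case 0
  thus ?case
    using rho_nonneg by (auto simp: start_0 airkp_inv_def less_eq_vec_def)
next
  case (Suc k)
  thus ?case
    using airkp_inv_update[OF A_nonneg airkp_inv_resolve] by (simp add: start_def)
qed

lemma airkp_inv_resolved: "airkp_inv A (stock \<omega> k, plan \<omega> k, planned_demand \<omega> k)"
  using airkp_inv_resolve[OF airkp_inv_start] by (simp add: resolved_def flip: resolved_eq)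

lemma stock_nonneg: "0 \<le> stock \<omega> k"
  using airkp_inv_inventory_nonneg[OF A_nonneg airkp_inv_resolved] .

lemma accepted_iff:
  "accepted \<omega> k \<longleftrightarrow> plan \<omega> k $ (\<omega> ! k) > 1 \<and>
     plan \<omega> k $ (\<omega> ! k) \<ge> planned_demand \<omega> k $ (\<omega> ! k) - plan \<omega> k $ (\<omega> ! k)"
  unfolding accepted_def resolved_eq by (rule airkp_accepts_iff[OF A_nonneg airkp_inv_resolved])

lemma stock_Suc: "stock \<omega> (Suc k) = stock \<omega> k - (if accepted \<omega> k then column (\<omega> ! k) A else 0)"
  by (simp add: stock_def[of _ "Suc k"] start_Suc)

text \<open>The state does not look ahead, which identifies the policy, given only a prefix, with
  the run along the full path.\<close>

lemma start_take:
  assumes "k \<le> m"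
  shows "start (take m \<omega>) k = start \<omega> k"
  using assms by (induction k) (auto simp: start_def min_def)

lemma total_reward_airkp:
  "total_reward r (airkp_policy A \<rho> p sol R T) \<omega> = (\<Sum>k<length \<omega>. gain \<omega> k)"
  unfolding total_reward_def
proof (intro sum.cong refl)
  fix k assume k: "k \<in> {..<length \<omega>}"
  hence "airkp_policy A \<rho> p sol R T (take k \<omega>) (\<omega> ! k) = accepted \<omega> k"
    using start_take[of k k \<omega>]
    by (simp add: airkp_policy_def accepted_def resolved_def min_def start_def)
  thus "(if airkp_policy A \<rho> p sol R T (take k \<omega>) (\<omega> ! k) then r $ (\<omega> ! k) else 0) = gain \<omega> k"
    by (simp add: gain_def)
qed

lemma gain_nonneg: "gain \<omega> k \<ge> 0"
  using r_nonneg by (simp add: gain_def)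

lemma planned_demand_Suc:
  assumes "Suc (Suc k) \<notin> R" "Suc k \<le> length \<omega>"
  shows "planned_demand \<omega> (Suc k) = planned_demand \<omega> k - axis (\<omega> ! k) 1"
  using not_resolved_at[OF assms] by (simp add: planned_demand_def[of _ "Suc k"] start_Suc)

lemma plan_Suc:
  assumes "Suc (Suc k) \<notin> R" "Suc k \<le> length \<omega>"
  shows "plan \<omega> (Suc k) = plan \<omega> k - (if accepted \<omega> k then axis (\<omega> ! k) 1 else 0)"
  using not_resolved_at[OF assms] by (simp add: plan_def[of _ "Suc k"] start_Suc)

text \<open>Both remaining demands lose the same unit vector at each arrival, and at the re-solving
  the planned one is the mean.\<close>

lemma planned_demand_eq:
  assumes "Suc a \<in> R" "a \<le> k" "k < T" "\<And>l. a < l \<Longrightarrow> l \<le> k \<Longrightarrow> Suc l \<notin> R" "length \<omega> = T"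
  shows "planned_demand \<omega> k - demand_from k \<omega> = mean_demand a - demand_from a \<omega>"
  using assms(2,3,4)
proof (induction k rule: dec_induct)
  case base
  thus ?case
    using assms by (simp add: resolved_at(1))
next
  case (step k)
  have "planned_demand \<omega> (Suc k) = planned_demand \<omega> k - axis (\<omega> ! k) 1"
    using step assms(5) by (intro planned_demand_Suc) auto
  moreover have "demand_from k \<omega> = demand_from (Suc k) \<omega> + axis (\<omega> ! k) 1"
    using step assms(5) by (intro demand_from_Suc) auto
  ultimately have "planned_demand \<omega> (Suc k) - demand_from (Suc k) \<omega> = planned_demand \<omega> k - demand_from k \<omega>"
    by simp
  thus ?case
    using step by simp
qed

text \<open>Every accepted unit is taken out of the plan, so planned value turns into gain one for
  one.\<close>

lemma plan_eq:
  assumes "a \<le> k" "k < T" "\<And>l. a < l \<Longrightarrow> l \<le> k \<Longrightarrow> Suc l \<notin> R" "length \<omega> = T"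
  shows "r \<bullet> plan \<omega> a = r \<bullet> plan \<omega> k + (\<Sum>l=a..<k. gain \<omega> l)"
  using assms(1,2,3)
proof (induction k rule: dec_induct)
  case (step k)
  have "plan \<omega> (Suc k) = plan \<omega> k - (if accepted \<omega> k then axis (\<omega> ! k) 1 else 0)"
    using step assms(4) by (intro plan_Suc) auto
  hence "r \<bullet> plan \<omega> k = r \<bullet> plan \<omega> (Suc k) + gain \<omega> k"
    by (simp add: gain_def inner_diff_right inner_axis)
  thus ?case
    using step by simp
qed auto

text \<open>The deviation enters twice: for replacing the realised by the mean demand in the
  program, and for the part of the plan left over at the end. At the horizon the planned demand
  equals the deviation itself, so \<open>airkp_inv\<close> bounds the leftover; the summand 1 allows
  for the unit that the threshold \<open>u $ j > 1\<close> withholds.\<close>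

lemma last_epoch_loss:
  assumes s: "Suc s \<in> R" "s < T" "\<And>l. s < l \<Longrightarrow> l < T \<Longrightarrow> Suc l \<notin> R" and len: "length \<omega> = T"
  shows "lp_value A r (stock \<omega> s) (demand_from s \<omega>) \<le> (\<Sum>l=s..<T. gain \<omega> l) +
    (\<Sum>j\<in>UNIV. r $ j * (1 + 2 * \<bar>mean_demand s $ j - demand_from s \<omega> $ j\<bar>))"
proof -
  define \<xi> where "\<xi> = mean_demand s - demand_from s \<omega>"
  \<comment> \<open>\<open>plan_eq\<close> and \<open>planned_demand_eq\<close> reach the decision
    at position \<open>k = T - 1\<close>; the effect of this last decision is read off from
    \<open>start \<omega> T\<close>.\<close>
  obtain k where T: "T = Suc k" using s(2) by (cases T) auto
  have "lp_optimal A r (stock \<omega> s) (mean_demand s) (plan \<omega> s)"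
    using solver stock_nonneg mean_demand_nonneg s len by (simp add: resolved_at lp_solver_def)
  hence "lp_value A r (stock \<omega> s) (mean_demand s) = r \<bullet> plan \<omega> s"
    by (rule lp_value_eq)
  moreover have "lp_value A r (stock \<omega> s) (demand_from s \<omega>) \<le>
      lp_value A r (stock \<omega> s) (mean_demand s) + (\<Sum>j\<in>UNIV. r $ j * \<bar>\<xi> $ j\<bar>)"
    using lp_value_demand_le[OF A_nonneg r_nonneg stock_nonneg demand_from_nonneg mean_demand_nonneg]
    by (simp add: \<xi>_def)
  moreover have "r \<bullet> plan \<omega> s = r \<bullet> plan \<omega> k + (\<Sum>l=s..<k. gain \<omega> l)"
    using s len T by (intro plan_eq) auto
  moreover obtain b u d where fin: "start \<omega> T = (b, u, d)" by (cases "start \<omega> T")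
  moreover have fin': "start \<omega> (Suc k) = (b, u, d)"
    by (simp only: T[symmetric] fin)
  moreover have "r \<bullet> plan \<omega> k = r \<bullet> u + gain \<omega> k"
    using fin' unfolding start_Suc
    by (auto simp: gain_def inner_diff_right inner_axis split: if_splits)
  moreover have "r \<bullet> u \<le> (\<Sum>j\<in>UNIV. r $ j * (1 + \<bar>\<xi> $ j\<bar>))"
  proof -
    have "d = planned_demand \<omega> k - axis (\<omega> ! k) 1"
      using fin' unfolding start_Suc by (auto split: if_splits)
    also have "\<dots> = planned_demand \<omega> k - demand_from k \<omega>"
      using demand_from_length[of \<omega>] len T by (simp add: demand_from_Suc)
    also have "\<dots> = \<xi>"
      unfolding \<xi>_def using s len T by (intro planned_demand_eq) auto
    finally have "d = \<xi>" .
    moreover have "u $ j \<le> 1 + \<bar>d $ j\<bar>" for j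
    proof -
      have "u $ j \<le> 1 \<or> 2 * u $ j \<le> 1 + d $ j \<or> u $ j \<le> d $ j"
        using airkp_inv_start[of \<omega> T] fin by (auto simp: airkp_inv_def)
      thus ?thesis by linarith
    qed
    ultimately show ?thesis
      using r_nonneg by (auto simp: inner_vec_def intro!: sum_mono mult_left_mono)
  qed
  moreover have "(\<Sum>l=s..<T. gain \<omega> l) = (\<Sum>l=s..<k. gain \<omega> l) + gain \<omega> k"
    using s(2) T by simp
  moreover have "(\<Sum>j\<in>UNIV. r $ j * (1 + 2 * \<bar>\<xi> $ j\<bar>)) =
      (\<Sum>j\<in>UNIV. r $ j * \<bar>\<xi> $ j\<bar>) + (\<Sum>j\<in>UNIV. r $ j * (1 + \<bar>\<xi> $ j\<bar>))"
    unfolding sum.distrib[symmetric] by (intro sum.cong) (auto simp: algebra_simps)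
  ultimately show ?thesis
    by (simp add: \<xi>_def)
qed


text \<open>\<open>plan \<omega> k\<close> solves the planned program, and a nearby \<open>y\<close>
  solves the one with the true demand, on the same inventory. The decision is compatible with both,
  so the plan stays optimal and the hindsight value is kept.\<close>

lemma lossless_step:
  assumes K: "K \<ge> 0" and stable: "\<And>b d D u. 0 \<le> D \<Longrightarrow> lp_optimal A r b d u \<Longrightarrow>
      \<exists>y. lp_optimal A r b D y \<and> (\<forall>j. \<bar>y $ j - u $ j\<bar> \<le> K * (\<Sum>i\<in>UNIV. \<bar>d $ i - D $ i\<bar>))"
    and opt: "lp_optimal A r (stock \<omega> k) (planned_demand \<omega> k) (plan \<omega> k)"
    and x: "x \<ge> 0" "\<And>j. \<bar>planned_demand \<omega> k $ j - demand_from k \<omega> $ j\<bar> \<le> x"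
    and big: "\<And>j. demand_from k \<omega> $ j \<ge> (3 + 2 * K * real CARD('n)) * (x + 1)"
    and k: "k < length \<omega>"
  shows "lp_value A r (stock \<omega> k) (demand_from k \<omega>) =
      gain \<omega> k + lp_value A r (stock \<omega> (Suc k)) (demand_from (Suc k) \<omega>)"
    and "lp_optimal A r (stock \<omega> (Suc k)) (planned_demand \<omega> k - axis (\<omega> ! k) 1)
      (plan \<omega> k - (if accepted \<omega> k then axis (\<omega> ! k) 1 else 0))"
proof -
  define j where "j = \<omega> ! k"
  define c where "c = K * real CARD('n) * x"
  obtain y where y: "lp_optimal A r (stock \<omega> k) (demand_from k \<omega>) y"
    "\<And>j. \<bar>y $ j - plan \<omega> k $ j\<bar> \<le>
      K * (\<Sum>i\<in>UNIV. \<bar>planned_demand \<omega> k $ i - demand_from k \<omega> $ i\<bar>)"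
    using stable[OF demand_from_nonneg opt] by blast
  have "K * (\<Sum>i\<in>UNIV. \<bar>planned_demand \<omega> k $ i - demand_from k \<omega> $ i\<bar>) \<le> K * (\<Sum>i\<in>(UNIV :: 'n set). x)"
    by (intro mult_left_mono sum_mono x K)
  hence near: "\<bar>y $ j - plan \<omega> k $ j\<bar> \<le> c"
    using y(2)[of j] by (simp add: c_def)
  \<comment> \<open>The margin covers \<open>x + 2 * c + 2\<close>, which the two cases ask for: the
    plan is compared with half the planned demand, which errs by \<open>x\<close>, and
    \<open>y\<close> differs from the plan by \<open>c\<close>.\<close>
  have "3 * x + 3 + 2 * c \<le> (3 + 2 * K * real CARD('n)) * (x + 1)"
    using K by (simp add: c_def algebra_simps)
  with big[of j] have big': "demand_from k \<omega> $ j \<ge> 3 * x + 3 + 2 * c" by linarith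
  have "c \<ge> 0" using K x(1) by (simp add: c_def)
  have D: "demand_from (Suc k) \<omega> = demand_from k \<omega> - axis j 1"
    using demand_from_Suc[OF k] by (simp add: j_def)
  have "lp_value A r (stock \<omega> k) (demand_from k \<omega>) =
      gain \<omega> k + lp_value A r (stock \<omega> (Suc k)) (demand_from (Suc k) \<omega>) \<and>
    lp_optimal A r (stock \<omega> (Suc k)) (planned_demand \<omega> k - axis (\<omega> ! k) 1)
      (plan \<omega> k - (if accepted \<omega> k then axis (\<omega> ! k) 1 else 0))"
  proof (cases "accepted \<omega> k")
    case True
    hence "plan \<omega> k $ j > 1" "plan \<omega> k $ j \<ge> planned_demand \<omega> k $ j - plan \<omega> k $ j"
      by (auto simp: accepted_iff j_def)
    moreover from this have "y $ j \<ge> 1"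
      using near x(2)[of j] big' \<open>c \<ge> 0\<close> x(1) by linarith
    ultimately show ?thesis
      using lp_optimal_accept[OF opt, of j] lp_optimal_accept[OF y(1), of j] y(1) True D
      by (simp add: lp_value_eq stock_Suc gain_def j_def inner_diff_right inner_axis)
  next
    case False
    hence "plan \<omega> k $ j \<le> 1 \<or> plan \<omega> k $ j < planned_demand \<omega> k $ j - plan \<omega> k $ j"
      by (auto simp: accepted_iff j_def)
    hence "y $ j \<le> demand_from k \<omega> $ j - 1" "plan \<omega> k $ j \<le> planned_demand \<omega> k $ j - 1"
      using near x(2)[of j] big' \<open>c \<ge> 0\<close> x(1) by linarith+
    thus ?thesis
      using lp_optimal_reject[OF opt, of j] lp_optimal_reject[OF y(1), of j] y(1) False D
      by (simp add: lp_value_eq stock_Suc gain_def j_def)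
  qed
  thus "lp_value A r (stock \<omega> k) (demand_from k \<omega>) =
      gain \<omega> k + lp_value A r (stock \<omega> (Suc k)) (demand_from (Suc k) \<omega>)"
    and "lp_optimal A r (stock \<omega> (Suc k)) (planned_demand \<omega> k - axis (\<omega> ! k) 1)
      (plan \<omega> k - (if accepted \<omega> k then axis (\<omega> ! k) 1 else 0))"
    by auto
qed

text \<open>Optimality of the plan is carried from period to period and renewed at a re-solving. The
  hindsight value depends only on stock and realised demand, so it passes through a re-solving
  unchanged. The radius \<open>x\<close> varies with \<open>k\<close> because the epochs have
  different scales.\<close>

lemma lossless_epochs:
  assumes K: "K \<ge> 0" and stable: "\<And>b d D u. 0 \<le> D \<Longrightarrow> lp_optimal A r b d u \<Longrightarrow>
      \<exists>y. lp_optimal A r b D y \<and> (\<forall>j. \<bar>y $ j - u $ j\<bar> \<le> K * (\<Sum>i\<in>UNIV. \<bar>d $ i - D $ i\<bar>))"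
    and len: "length \<omega> = T" and s: "s < T"
    and close: "\<And>k. k < s \<Longrightarrow> \<exists>x\<ge>0. \<forall>j. \<bar>planned_demand \<omega> k $ j - demand_from k \<omega> $ j\<bar> \<le> x \<and>
      demand_from k \<omega> $ j \<ge> (3 + 2 * K * real CARD('n)) * (x + 1)"
  shows "lp_value A r (real T *\<^sub>R \<rho>) (demand_from 0 \<omega>) =
    (\<Sum>k<s. gain \<omega> k) + lp_value A r (stock \<omega> s) (demand_from s \<omega>)"
proof -
  have fresh: "lp_optimal A r (stock \<omega> k) (planned_demand \<omega> k) (plan \<omega> k)" if "Suc k \<in> R" "k < T" for k
    using that len solver stock_nonneg mean_demand_nonneg by (simp add: resolved_at lp_solver_def)
  have "lp_optimal A r (stock \<omega> k) (planned_demand \<omega> k) (plan \<omega> k) \<and>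
    lp_value A r (real T *\<^sub>R \<rho>) (demand_from 0 \<omega>) =
      (\<Sum>l<k. gain \<omega> l) + lp_value A r (stock \<omega> k) (demand_from k \<omega>)" if "k \<le> s" for k
    using that
  proof (induction k)
    case 0
    thus ?case
      using fresh[of 0] first s by (simp add: stock_def start_0)
  next
    case (Suc k)
    obtain x where x: "x \<ge> 0" "\<And>j. \<bar>planned_demand \<omega> k $ j - demand_from k \<omega> $ j\<bar> \<le> x"
      "\<And>j. demand_from k \<omega> $ j \<ge> (3 + 2 * K * real CARD('n)) * (x + 1)"
      using close[of k] Suc.prems by auto
    have "k < length \<omega>" using Suc.prems s len by simp
    note step = lossless_step[OF K stable _ x this]
    have "lp_optimal A r (stock \<omega> (Suc k)) (planned_demand \<omega> (Suc k)) (plan \<omega> (Suc k))"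
    proof (cases "Suc (Suc k) \<in> R")
      case True
      thus ?thesis using fresh Suc.prems s by simp
    next
      case False
      thus ?thesis
        using step(2) Suc s len by (simp add: planned_demand_Suc plan_Suc)
    qed
    thus ?case
      using step(1) Suc by simp
  qed
  thus ?thesis by simp
qed

end

section \<open>Concentration of the demand\<close>

lemma map_map_replicate_pmf:
  "map_pmf (map f) (replicate_pmf n p) = replicate_pmf n (map_pmf f p)"
proof (induction n)
  case (Suc n)
  have "map_pmf (map f) (replicate_pmf (Suc n) p) =
      bind_pmf p (\<lambda>x. bind_pmf (replicate_pmf n p) (\<lambda>xs. return_pmf (f x # map f xs)))"
    by (simp add: map_bind_pmf)
  also have "\<dots> = bind_pmf (map_pmf f p)
      (\<lambda>y. bind_pmf (map_pmf (map f) (replicate_pmf n p)) (\<lambda>ys. return_pmf (y # ys)))"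
    by (simp add: bind_map_pmf)
  finally show ?case by (simp add: Suc.IH)
qed simp

lemma map_drop_replicate_pmf:
  assumes "a \<le> n"
  shows "map_pmf (drop a) (replicate_pmf n p) = replicate_pmf (n - a) p"
proof -
  have "map_pmf (drop a) (replicate_pmf n p) = map_pmf (drop a) (replicate_pmf (a + (n - a)) p)"
    using assms by simp
  also have "\<dots> = bind_pmf (replicate_pmf a p) (\<lambda>xs. bind_pmf (replicate_pmf (n - a) p)
      (\<lambda>ys. return_pmf (drop a (xs @ ys))))"
    by (simp only: replicate_pmf_distrib map_bind_pmf map_return_pmf)
  also have "\<dots> = bind_pmf (replicate_pmf a p) (\<lambda>xs. replicate_pmf (n - a) p)"
    by (intro bind_pmf_cong refl) (auto simp: set_replicate_pmf bind_return_pmf')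
  finally show ?thesis by simp
qed

lemma count_list_replicate_pmf:
  "map_pmf (\<lambda>xs. count_list xs j) (replicate_pmf n p) = binomial_pmf n (pmf p j)"
proof -
  have "map_pmf (\<lambda>x. x = j) p = bernoulli_pmf (pmf p j)"
  proof (rule pmf_eqI)
    fix i
    have "pmf (map_pmf (\<lambda>x. x = j) p) i = measure_pmf.prob p {x. (x = j) = i}"
      by (simp add: pmf_map vimage_def)
    also have "\<dots> = pmf (bernoulli_pmf (pmf p j)) i"
    proof (cases i)
      case False
      have "{x. x \<noteq> j} = space (measure_pmf p) - {j}" by auto
      thus ?thesis
        using False measure_pmf.prob_compl[of "{j}" p] by (simp add: measure_pmf_single pmf_le_1)
    qed (simp add: measure_pmf_single pmf_le_1)
    finally show "pmf (map_pmf (\<lambda>x. x = j) p) i = pmf (bernoulli_pmf (pmf p j)) i" .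
  qed
  hence "map_pmf (length \<circ> filter id) (map_pmf (map (\<lambda>x. x = j)) (replicate_pmf n p)) =
      binomial_pmf n (pmf p j)"
    by (simp add: map_map_replicate_pmf binomial_pmf_altdef pmf_le_1)
  moreover have "length (filter id (map (\<lambda>x. x = j) xs)) = count_list xs j" for xs
    by (induction xs) auto
  ultimately show ?thesis
    by (simp add: map_pmf_comp o_def)
qed

lemma demand_from_distribution:
  assumes "a \<le> T"
  shows "map_pmf (\<lambda>\<omega>. demand_from a \<omega> $ j) (replicate_pmf T p) =
    map_pmf real (binomial_pmf (T - a) (pmf p j))"
proof -
  have "map_pmf (\<lambda>\<omega>. demand_from a \<omega> $ j) (replicate_pmf T p) =
      map_pmf real (map_pmf (\<lambda>xs. count_list xs j) (map_pmf (drop a) (replicate_pmf T p)))"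
    by (simp add: map_pmf_comp demand_from_def)
  thus ?thesis
    by (simp add: map_drop_replicate_pmf[OF assms] count_list_replicate_pmf)
qed

text \<open>Hoeffding's inequality for the binomial number of type \<open>j\<close> arrivals among
  the last \<open>T - a\<close>.\<close>

lemma demand_from_tail:
  assumes "a < T" "x \<ge> 0"
  shows "measure_pmf.prob (replicate_pmf T p)
      {\<omega>. \<bar>demand_from a \<omega> $ j - real (T - a) * pmf p j\<bar> \<ge> x} \<le> 2 * exp (- 2 * x\<^sup>2 / real (T - a))"
proof -
  interpret binomial_distribution "T - a" "pmf p j"
    by standard (simp add: pmf_le_1)
  have "measure_pmf.prob (replicate_pmf T p) {\<omega>. \<bar>demand_from a \<omega> $ j - real (T - a) * pmf p j\<bar> \<ge> x} =
      measure_pmf.prob (map_pmf (\<lambda>\<omega>. demand_from a \<omega> $ j) (replicate_pmf T p))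
        {z. \<bar>z - real (T - a) * pmf p j\<bar> \<ge> x}"
    by (simp add: vimage_def)
  also have "\<dots> = measure_pmf.prob (binomial_pmf (T - a) (pmf p j))
      {z. \<bar>real z - real (T - a) * pmf p j\<bar> \<ge> x}"
    using assms by (subst demand_from_distribution) (simp_all add: vimage_def)
  also have "\<dots> \<le> 2 * exp (- 2 * x\<^sup>2 / real (T - a))"
    using assms by (intro prob_abs_ge) auto
  finally show ?thesis .
qed

text \<open>The weights are Bernstein polynomials at \<open>q\<close>, whose sums against
  \<open>1\<close>, \<open>k\<close> and \<open>k * (k - 1)\<close> are known; the square is
  expanded in these.\<close>

lemma binomial_variance:
  assumes "q \<in> {0..1}"
  shows "measure_pmf.expectation (binomial_pmf n q) (\<lambda>k. (real k - n * q)\<^sup>2) = n * q * (1 - q)"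
proof -
  have B: "Bernstein n k q = (real (n choose k) * q ^ k * (1 - q) ^ (n - k))" for k
    by (simp add: Bernstein_def)
  have "measure_pmf.expectation (binomial_pmf n q) (\<lambda>k. (real k - n * q)\<^sup>2) =
      (\<Sum>k\<le>n. (real k - n * q)\<^sup>2 * Bernstein n k q)"
    using assms by (subst expectation_binomial_pmf') (auto simp: B mult_ac)
  also have "\<dots> = (\<Sum>k\<le>n. real k * (real k - 1) * Bernstein n k q +
      (1 - 2 * n * q) * (real k * Bernstein n k q) + (n * q)\<^sup>2 * Bernstein n k q)"
    by (intro sum.cong) (auto simp: power2_eq_square algebra_simps)
  also have "\<dots> = real n * (real n - 1) * q\<^sup>2 + (1 - 2 * n * q) * (n * q) + (n * q)\<^sup>2"
    using sum_kk_Bernstein[of n q] sum_k_Bernstein[of n q] sum_Bernstein[of n q]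
    by (simp add: sum.distrib flip: sum_distrib_left)
  finally show ?thesis
    by (simp add: power2_eq_square algebra_simps)
qed

lemma finite_set_replicate_pmf:
  fixes p :: "'n::finite pmf"
  shows "finite (set_pmf (replicate_pmf n p))"
proof -
  have "set_pmf (replicate_pmf n p) \<subseteq> {xs. set xs \<subseteq> UNIV \<and> length xs = n}"
    unfolding set_replicate_pmf by blast
  thus ?thesis
    by (rule finite_subset) (rule finite_lists_length_eq[OF finite])
qed

lemma demand_from_mean_deviation:
  fixes p :: "'n::finite pmf"
  assumes "a < T"
  shows "measure_pmf.expectation (replicate_pmf T p)
      (\<lambda>\<omega>. \<bar>real (T - a) * pmf p j - demand_from a \<omega> $ j\<bar>) \<le> sqrt (real (T - a))"
proof -
  define n where "n = T - a"
  define q where "q = pmf p j"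
  have q: "q \<in> {0..1}" by (simp add: q_def pmf_le_1)
  define s where "s = sqrt (real n)"
  have s: "s > 0" "s\<^sup>2 = real n" using assms by (simp_all add: s_def n_def)
  \<comment> \<open>The arithmetic-geometric mean inequality in place of Cauchy-Schwarz. With
    \<open>s = sqrt n\<close> and variance at most \<open>n\<close>, both terms come out at most
    \<open>s\<close>.\<close>
  have amgm: "\<bar>z\<bar> \<le> (z\<^sup>2 / s + s) / 2" for z
  proof -
    have "0 \<le> (\<bar>z\<bar> - s)\<^sup>2" by simp
    hence "2 * \<bar>z\<bar> * s \<le> z\<^sup>2 + s\<^sup>2"
      by (simp add: power2_diff)
    hence "2 * \<bar>z\<bar> \<le> (z\<^sup>2 + s\<^sup>2) / s"
      using s(1) by (simp add: pos_le_divide_eq)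
    also have "\<dots> = z\<^sup>2 / s + s"
      using s(1) by (simp add: add_divide_distrib power2_eq_square)
    finally show ?thesis by simp
  qed
  have "measure_pmf.expectation (replicate_pmf T p) (\<lambda>\<omega>. \<bar>real n * q - demand_from a \<omega> $ j\<bar>) =
      measure_pmf.expectation (map_pmf (\<lambda>\<omega>. demand_from a \<omega> $ j) (replicate_pmf T p)) (\<lambda>z. \<bar>real n * q - z\<bar>)"
    by simp
  also have "\<dots> = measure_pmf.expectation (binomial_pmf n q) (\<lambda>k. \<bar>real n * q - real k\<bar>)"
    using assms by (subst demand_from_distribution) (auto simp: n_def q_def)
  also have "\<dots> \<le> measure_pmf.expectation (binomial_pmf n q) (\<lambda>k. ((real k - n * q)\<^sup>2 / s + s) / 2)"
    using q amgm by (intro integral_mono) (auto simp: abs_minus_commute)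
  also have "\<dots> = (measure_pmf.expectation (binomial_pmf n q) (\<lambda>k. (real k - n * q)\<^sup>2) / s + s) / 2"
    unfolding integral_divide_zero
    by (subst Bochner_Integration.integral_add[OF integrable_binomial_pmf[OF q] integrable_binomial_pmf[OF q]])
       (simp add: integral_divide_zero)
  also have "\<dots> = (n * q * (1 - q) / s + s) / 2"
    using q by (simp add: binomial_variance)
  also have "\<dots> \<le> (n / s + s) / 2"
  proof -
    have "q * (1 - q) \<le> 1" using q by (intro mult_le_one) auto
    hence "real n * (q * (1 - q)) \<le> real n * 1" by (intro mult_left_mono) auto
    hence "n * q * (1 - q) \<le> n" by (simp only: mult.assoc mult_1_right)
    thus ?thesis
      using s(1) by (intro divide_right_mono add_right_mono) auto
  qed
  also have "\<dots> = s"
    using s(1) by (simp add: power2_eq_square flip: s(2))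
  finally show ?thesis by (simp add: n_def q_def s_def)
qed

section \<open>Regret of AIR-KP\<close>

text \<open>The program with the realised demand bounds the reward of each feasible policy path by
  path, hence its expected value bounds every mixture of policies.\<close>

lemma opt_value_le_fluid:
  fixes A :: "real^'n::finite^'m::finite"
  assumes "0 \<le> \<rho>"
  shows "opt_value A r \<rho> p T \<le>
    measure_pmf.expectation (replicate_pmf T p) (\<lambda>\<omega>. lp_value A r (real T *\<^sub>R \<rho>) (demand_from 0 \<omega>))"
    (is "_ \<le> ?B")
proof -
  have path: "expected_reward r p T \<pi> \<le> ?B" if "feasible_policy A \<rho> T \<pi>" for \<pi>
    unfolding expected_reward_def using that assms
    by (intro integral_mono_AE integrable_measure_pmf_finite finite_set_replicate_pmf)
       (auto simp: AE_measure_pmf_iff set_replicate_pmf intro!: total_reward_le_lp_value)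
  have "feasible_policy A \<rho> T (\<lambda>_ _. False)"
    by (simp add: feasible_policy_def)
  hence ne: "return_pmf (\<lambda>_ _. False) \<in> {q. \<forall>\<pi>\<in>set_pmf q. feasible_policy A \<rho> T \<pi>}"
    by simp
  have "expected_reward r p T (\<lambda>_ _. False) = 0"
    by (simp add: expected_reward_def total_reward_def[abs_def])
  hence "0 \<le> ?B"
    using path[OF \<open>feasible_policy A \<rho> T (\<lambda>_ _. False)\<close>] by simp
  show ?thesis
    unfolding opt_value_def
  proof (rule cSUP_least)
    show "{q. \<forall>\<pi>\<in>set_pmf q. feasible_policy A \<rho> T \<pi>} \<noteq> {}"
      using ne by blast
  next
    fix q assume q: "q \<in> {q. \<forall>\<pi>\<in>set_pmf q. feasible_policy A \<rho> T \<pi>}"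
    show "measure_pmf.expectation q (expected_reward r p T) \<le> ?B"
    proof (cases "integrable (measure_pmf q) (expected_reward r p T)")
      case True
      thus ?thesis
        using q path by (intro measure_pmf.integral_le_const) (auto simp: AE_measure_pmf_iff)
    next
      \<comment> \<open>An expectation that does not exist is 0 by convention, so
        \<open>0 \<le> ?B\<close> settles this case.\<close>
      case False
      thus ?thesis
        using \<open>0 \<le> ?B\<close> by (simp add: not_integrable_integral_eq)
    qed
  qed
qed

context airkp
begin

lemma fluid_value_le:
  assumes "length \<omega> = T"
  shows "lp_value A r (real T *\<^sub>R \<rho>) (demand_from 0 \<omega>) \<le> (\<Sum>j\<in>UNIV. r $ j) * real T"
  using assms demand_from_le[of 0 \<omega>] rho_nonneg
  by (intro lp_value_le_demand r_nonneg demand_from_nonneg) (auto simp: less_eq_vec_def)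

text \<open>Outside \<open>B\<close> only the last epoch loses, in expectation of the order of a
  standard deviation. On \<open>B\<close> the loss is at most the whole hindsight value, a multiple
  of \<open>T\<close>.\<close>

lemma regret_le:
  assumes "s < T" and last: "Suc s \<in> R" "\<And>l. s < l \<Longrightarrow> l < T \<Longrightarrow> Suc l \<notin> R"
    and lossless: "\<And>\<omega>. length \<omega> = T \<Longrightarrow> \<omega> \<notin> B \<Longrightarrow>
      lp_value A r (real T *\<^sub>R \<rho>) (demand_from 0 \<omega>) =
        (\<Sum>k<s. gain \<omega> k) + lp_value A r (stock \<omega> s) (demand_from s \<omega>)"
  shows "regret A r \<rho> p T (airkp_policy A \<rho> p sol R T) \<le>
    (\<Sum>j\<in>UNIV. r $ j) * (1 + 2 * sqrt (real (T - s)) + real T * measure_pmf.prob (replicate_pmf T p) B)"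
proof -
  define P where "P = replicate_pmf T p"
  define rr where "rr = (\<Sum>j\<in>UNIV. r $ j)"
  define V where "V = (\<lambda>\<omega>. lp_value A r (real T *\<^sub>R \<rho>) (demand_from 0 \<omega>))"
  define W where "W = total_reward r (airkp_policy A \<rho> p sol R T)"
  define L where "L \<omega> = (\<Sum>j\<in>UNIV. r $ j * (1 + 2 * \<bar>real (T - s) * pmf p j - demand_from s \<omega> $ j\<bar>))" for \<omega>
  have int: "integrable (measure_pmf P) f" for f :: "'n list \<Rightarrow> real"
    unfolding P_def by (intro integrable_measure_pmf_finite finite_set_replicate_pmf)
  have "rr \<ge> 0" unfolding rr_def using r_nonneg by (intro sum_nonneg) auto
  have "L \<omega> \<ge> 0" for \<omega>
    unfolding L_def using r_nonneg by (intro sum_nonneg) auto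
  have path: "V \<omega> - W \<omega> \<le> L \<omega> + rr * real T * indicator B \<omega>" if "\<omega> \<in> set_pmf P" for \<omega>
  proof -
    have len: "length \<omega> = T" using that by (auto simp: P_def set_replicate_pmf)
    have W: "W \<omega> = (\<Sum>k<T. gain \<omega> k)"
      by (simp add: W_def total_reward_airkp len)
    show ?thesis
    proof (cases "\<omega> \<in> B")
      case True
      have "W \<omega> \<ge> 0" unfolding W by (intro sum_nonneg gain_nonneg)
      thus ?thesis
        using fluid_value_le[OF len] \<open>L \<omega> \<ge> 0\<close> True by (simp add: V_def rr_def)
    next
      case False
      have "(\<Sum>k<T. gain \<omega> k) = (\<Sum>k<s. gain \<omega> k) + (\<Sum>k=s..<T. gain \<omega> k)"
        using \<open>s < T\<close> by (simp add: lessThan_atLeast0 sum.atLeastLessThan_concat)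
      moreover have "lp_value A r (stock \<omega> s) (demand_from s \<omega>) \<le> (\<Sum>k=s..<T. gain \<omega> k) + L \<omega>"
        using last_epoch_loss[OF last(1) \<open>s < T\<close> last(2) len] by (simp add: L_def mean_demand_def)
      ultimately show ?thesis
        using lossless[OF len False] False by (simp add: V_def W)
    qed
  qed
  have "regret A r \<rho> p T (airkp_policy A \<rho> p sol R T) \<le>
      measure_pmf.expectation P V - measure_pmf.expectation P W"
    using opt_value_le_fluid[OF rho_nonneg, of A r p T]
    by (simp add: regret_def expected_reward_def P_def V_def W_def)
  also have "\<dots> = measure_pmf.expectation P (\<lambda>\<omega>. V \<omega> - W \<omega>)"
    by (rule Bochner_Integration.integral_diff[symmetric, OF int int])
  also have "\<dots> \<le> measure_pmf.expectation P (\<lambda>\<omega>. L \<omega> + rr * real T * indicator B \<omega>)"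
    by (intro integral_mono_AE int) (auto simp: AE_measure_pmf_iff path)
  also have "\<dots> = measure_pmf.expectation P L + rr * real T * measure_pmf.prob P B"
    by (subst Bochner_Integration.integral_add[OF int int]) simp
  also have "measure_pmf.expectation P L = (\<Sum>j\<in>UNIV. measure_pmf.expectation P
      (\<lambda>\<omega>. r $ j * (1 + 2 * \<bar>real (T - s) * pmf p j - demand_from s \<omega> $ j\<bar>)))"
    unfolding L_def by (rule Bochner_Integration.integral_sum) (rule int)
  also have "\<dots> = (\<Sum>j\<in>UNIV. r $ j * (1 + 2 *
      measure_pmf.expectation P (\<lambda>\<omega>. \<bar>real (T - s) * pmf p j - demand_from s \<omega> $ j\<bar>)))"
  proof (intro sum.cong refl)
    fix j
    show "measure_pmf.expectation P (\<lambda>\<omega>. r $ j * (1 + 2 * \<bar>real (T - s) * pmf p j - demand_from s \<omega> $ j\<bar>)) =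
      r $ j * (1 + 2 * measure_pmf.expectation P (\<lambda>\<omega>. \<bar>real (T - s) * pmf p j - demand_from s \<omega> $ j\<bar>))"
      unfolding integral_mult_right_zero
      by (subst Bochner_Integration.integral_add[OF int int]) simp
  qed
  also have "\<dots> \<le> (\<Sum>j\<in>UNIV. r $ j * (1 + 2 * sqrt (real (T - s))))"
    using demand_from_mean_deviation[OF \<open>s < T\<close>, of p] r_nonneg
    by (intro sum_mono mult_left_mono add_left_mono) (auto simp: P_def)
  also have "\<dots> = rr * (1 + 2 * sqrt (real (T - s)))"
    by (simp add: rr_def sum_distrib_right)
  finally show ?thesis
    by (simp add: rr_def P_def algebra_simps)
qed

text \<open>Serves the finitely many small horizons, for which the constant absorbs the factor
  \<open>T\<close>.\<close>

lemma regret_le_horizon: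
  "regret A r \<rho> p T (airkp_policy A \<rho> p sol R T) \<le> (\<Sum>j\<in>UNIV. r $ j) * real T"
proof -
  have "measure_pmf.expectation (replicate_pmf T p)
      (\<lambda>\<omega>. lp_value A r (real T *\<^sub>R \<rho>) (demand_from 0 \<omega>)) \<le> (\<Sum>j\<in>UNIV. r $ j) * real T"
  proof (rule measure_pmf.integral_le_const)
    show "AE \<omega> in measure_pmf (replicate_pmf T p).
        lp_value A r (real T *\<^sub>R \<rho>) (demand_from 0 \<omega>) \<le> (\<Sum>j\<in>UNIV. r $ j) * real T"
      using fluid_value_le by (simp add: AE_measure_pmf_iff set_replicate_pmf)
  qed (rule integrable_measure_pmf_finite, rule finite_set_replicate_pmf)
  moreover have "0 \<le> expected_reward r p T (airkp_policy A \<rho> p sol R T)"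
    unfolding expected_reward_def
  proof (rule integral_nonneg_AE, rule AE_I2)
    fix \<omega> show "0 \<le> total_reward r (airkp_policy A \<rho> p sol R T) \<omega>"
      unfolding total_reward_airkp by (intro sum_nonneg gain_nonneg)
  qed
  ultimately show ?thesis
    using opt_value_le_fluid[OF rho_nonneg, of A r p T] by (simp add: regret_def)
qed

end

section \<open>Resolving times\<close>

text \<open>Meant for the failure probability: its product with the linear worst-case loss stays
  bounded.\<close>

lemma exp_powr_decay:
  fixes \<gamma> \<delta> :: real
  assumes "\<gamma> > 0" "\<delta> > 0"
  shows "eventually (\<lambda>n. real n * exp (- \<gamma> * real n powr \<delta>) \<le> 1) at_top"
proof -
  have "((\<lambda>x :: real. x * exp (- \<gamma> * x powr \<delta>)) \<longlongrightarrow> 0) at_top"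
    using assms by real_asymp
  hence "eventually (\<lambda>x. x * exp (- \<gamma> * x powr \<delta>) < 1) at_top"
    by (rule order_tendstoD) simp
  hence "eventually (\<lambda>n. real n * exp (- \<gamma> * real n powr \<delta>) < 1) at_top"
    by (rule eventually_compose_filterlim) (rule filterlim_real_sequentially)
  thus ?thesis by eventually_elim simp
qed

text \<open>Period \<open>epoch \<beta> T i + 1\<close> is the \<open>i\<close>-th resolving time, where the 0-th one is period 1. About
  \<open>T powr (\<beta> ^ i)\<close> periods remain then.\<close>

definition epoch :: "real \<Rightarrow> nat \<Rightarrow> nat \<Rightarrow> nat" where
  "epoch \<beta> T i = (if i = 0 then 0 else nat \<lceil>real T - real T powr (\<beta> ^ i)\<rceil> - 1)"

context
  fixes \<beta> :: real and T :: nat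
  assumes \<beta>: "0 < \<beta>" "\<beta> < 1" and T: "T \<ge> 2"
begin

text \<open>As \<open>\<beta> ^ i < 1\<close> and \<open>T \<ge> 2\<close>, the ceiling is at least
  1, so the natural subtraction in \<open>epoch\<close> is exact.\<close>

lemma Suc_epoch:
  assumes "i > 0"
  shows "int (Suc (epoch \<beta> T i)) = \<lceil>real T - real T powr (\<beta> ^ i)\<rceil>"
proof -
  have "\<beta> ^ i < 1"
    using \<beta> assms by (simp add: power_less_one_iff)
  hence "real T powr (\<beta> ^ i) < real T powr 1"
    using T by (intro powr_less_mono) auto
  hence "\<lceil>real T - real T powr (\<beta> ^ i)\<rceil> \<ge> 1"
    using T by simp
  thus ?thesis
    using assms by (simp add: epoch_def)
qed

lemma resolving_set_eq:
  assumes "M \<ge> 1"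
  shows "resolving_set M \<beta> T = (\<lambda>i. Suc (epoch \<beta> T i)) ` {..<M}"
proof -
  have "nat \<lceil>real T - real T powr (\<beta> ^ i)\<rceil> = Suc (epoch \<beta> T i)" if "i \<in> {1..M - 1}" for i
    using Suc_epoch[of i] that by (simp flip: Suc_epoch)
  hence "(\<lambda>k. nat \<lceil>real T - real T powr (\<beta> ^ k)\<rceil>) ` {1..M - 1} = (\<lambda>i. Suc (epoch \<beta> T i)) ` {1..M - 1}"
    by (intro image_cong) auto
  moreover have "{..<M} = insert 0 {1..M - 1}"
    using assms by auto
  ultimately show ?thesis
    by (simp add: resolving_set_def epoch_def[of \<beta> T 0])
qed

text \<open>Rounding adds at most 1 to the number of remaining periods, and
  \<open>T powr (\<beta> ^ i) \<ge> 1\<close> absorbs this into the factor 2.\<close>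

lemma epoch_bounds:
  "epoch \<beta> T i < T" "real T powr (\<beta> ^ i) \<le> real (T - epoch \<beta> T i)"
  "real (T - epoch \<beta> T i) \<le> 2 * real T powr (\<beta> ^ i)"
proof -
  have W: "real T powr (\<beta> ^ i) \<ge> 1"
    using T \<beta> by (intro ge_one_powr_ge_zero) auto
  have "epoch \<beta> T i < T \<and> real T powr (\<beta> ^ i) \<le> real (T - epoch \<beta> T i) \<and>
      real (T - epoch \<beta> T i) \<le> 2 * real T powr (\<beta> ^ i)"
  proof (cases "i = 0")
    case False
    define c where "c = \<lceil>real T - real T powr (\<beta> ^ i)\<rceil>"
    have c: "int (Suc (epoch \<beta> T i)) = c"
      using Suc_epoch[of i] False by (simp add: c_def)
    have c': "real_of_int c < real T - real T powr (\<beta> ^ i) + 1" "real T - real T powr (\<beta> ^ i) \<le> real_of_int c"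
      unfolding c_def by linarith+
    have e: "real (epoch \<beta> T i) = real_of_int c - 1"
      using c by linarith
    have "real (epoch \<beta> T i) < real T"
      unfolding e using c' W by linarith
    hence less: "epoch \<beta> T i < T" by simp
    hence "real (T - epoch \<beta> T i) = real T - (real_of_int c - 1)"
      using e by (simp add: of_nat_diff)
    with less show ?thesis
      using c' W by linarith
  qed (use T in \<open>simp add: epoch_def\<close>)
  thus "epoch \<beta> T i < T" "real T powr (\<beta> ^ i) \<le> real (T - epoch \<beta> T i)"
    "real (T - epoch \<beta> T i) \<le> 2 * real T powr (\<beta> ^ i)"
    by auto
qed

lemma powr_power_antimono:
  assumes "i \<le> k"
  shows "real T powr (\<beta> ^ k) \<le> real T powr (\<beta> ^ i)"
  using assms T \<beta> by (intro powr_mono power_decreasing) auto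

lemma epoch_mono:
  assumes "i \<le> k"
  shows "epoch \<beta> T i \<le> epoch \<beta> T k"
proof (cases "i = 0")
  case False
  have "\<lceil>real T - real T powr (\<beta> ^ i)\<rceil> \<le> \<lceil>real T - real T powr (\<beta> ^ k)\<rceil>"
    using powr_power_antimono[OF assms] by (intro ceiling_mono) simp
  thus ?thesis
    using False assms Suc_epoch[of i] Suc_epoch[of k] by linarith
qed (simp add: epoch_def)

lemma resolved_within_epoch:
  assumes "M \<ge> 1" "epoch \<beta> T i < l" "l < epoch \<beta> T (Suc i)"
  shows "Suc l \<notin> resolving_set M \<beta> T"
proof
  assume "Suc l \<in> resolving_set M \<beta> T"
  then obtain k where k: "l = epoch \<beta> T k"
    using assms(1) by (auto simp: resolving_set_eq)
  show False
    using epoch_mono[of k i] epoch_mono[of "Suc i" k] assms(2,3) unfolding k by (cases "k \<le> i") auto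
qed

lemma not_resolved_after_last_epoch:
  assumes "M \<ge> 1" "epoch \<beta> T (M - 1) < l"
  shows "Suc l \<notin> resolving_set M \<beta> T"
proof
  assume "Suc l \<in> resolving_set M \<beta> T"
  then obtain k where k: "l = epoch \<beta> T k" "k < M"
    using assms(1) by (auto simp: resolving_set_eq)
  hence "k \<le> M - 1" by simp
  from epoch_mono[OF this] show False
    using assms(2) k(1) by simp
qed

lemma epoch_containing:
  assumes "k < epoch \<beta> T (M - 1)"
  obtains i where "i < M - 1" "epoch \<beta> T i \<le> k" "k < epoch \<beta> T (Suc i)"
proof -
  \<comment> \<open>Neighbouring epochs may start at the same position after rounding; the greatest
    index not past \<open>k\<close> selects one that contains \<open>k\<close>.\<close>
  define i where "i = (GREATEST i. epoch \<beta> T i \<le> k \<and> i \<le> M - 1)"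
  have "epoch \<beta> T 0 \<le> k \<and> 0 \<le> M - 1" by (simp add: epoch_def)
  hence i: "epoch \<beta> T i \<le> k \<and> i \<le> M - 1"
    unfolding i_def by (rule GreatestI_nat[where b = "M - 1"]) auto
  hence "i \<noteq> M - 1" using assms by auto
  hence "i < M - 1" using i by simp
  moreover have "k < epoch \<beta> T (Suc i)"
  proof (rule ccontr)
    assume "\<not> ?thesis"
    hence "Suc i \<le> (GREATEST i. epoch \<beta> T i \<le> k \<and> i \<le> M - 1)"
      using \<open>i < M - 1\<close> by (intro Greatest_le_nat[where b = "M - 1"]) auto
    thus False unfolding i_def[symmetric] by simp
  qed
  ultimately show ?thesis using that i by blast
qed

end

text \<open>The deviations are measured against \<open>T powr (\<beta> ^ Suc i)\<close>, the order of the number of periods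
  remaining at the end of epoch \<open>i\<close>, because all demands in the epoch are at least of this order.\<close>

definition large_deviation :: "'n::finite pmf \<Rightarrow> real \<Rightarrow> real \<Rightarrow> nat \<Rightarrow> nat \<Rightarrow> 'n list set" where
  "large_deviation p c \<beta> M T = (\<Union>i<M - 1. \<Union>l\<in>{i, Suc i}. \<Union>j.
     {\<omega>. \<bar>demand_from (epoch \<beta> T l) \<omega> $ j - real (T - epoch \<beta> T l) * pmf p j\<bar> \<ge> c * real T powr (\<beta> ^ Suc i)})"

text \<open>Hoeffding's exponent for epoch \<open>i\<close> is of the order
  \<open>T powr (2 * \<beta> ^ Suc i - \<beta> ^ i)\<close>, that is
  \<open>T powr (\<beta> ^ i * (2 * \<beta> - 1))\<close>; replacing \<open>\<beta> ^ i\<close> by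
  \<open>\<beta> ^ M\<close> gives a bound common to all epochs. The factor
  \<open>4 * M * CARD('n)\<close> accounts for epochs, their two ends, the types and the two
  tails.\<close>

lemma prob_large_deviation:
  fixes p :: "'n::finite pmf"
  assumes "1 / 2 < \<beta>" "\<beta> < 1" "T \<ge> 2" "c > 0"
  shows "measure_pmf.prob (replicate_pmf T p) (large_deviation p c \<beta> M T) \<le>
    real (4 * M * CARD('n)) * exp (- c\<^sup>2 * real T powr (\<beta> ^ M * (2 * \<beta> - 1)))"
proof -
  define q where "q = 2 * exp (- c\<^sup>2 * real T powr (\<beta> ^ M * (2 * \<beta> - 1)))"
  have \<beta>: "0 < \<beta>" using assms by simp
  note epoch = epoch_bounds[OF \<beta> assms(2,3)]
  define E where "E i l j = {\<omega> :: 'n list. \<bar>demand_from (epoch \<beta> T l) \<omega> $ j -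
    real (T - epoch \<beta> T l) * pmf p j\<bar> \<ge> c * real T powr (\<beta> ^ Suc i)}" for i l j
  let ?P = "measure_pmf.prob (replicate_pmf T p)"
  have E: "?P (E i l j) \<le> q" if "i < M - 1" "l \<in> {i, Suc i}" for i l j
  proof -
    define n where "n = real (T - epoch \<beta> T l)"
    have "n \<le> 2 * real T powr (\<beta> ^ l)"
      using epoch(3)[of l] by (simp add: n_def)
    also have "\<dots> \<le> 2 * real T powr (\<beta> ^ i)"
      using powr_power_antimono[OF \<beta> assms(2,3), of i l] that(2) by auto
    finally have n: "n \<le> 2 * real T powr (\<beta> ^ i)" .
    have "n > 0" using epoch(1)[of l] by (simp add: n_def)
    have "real T powr (\<beta> ^ M * (2 * \<beta> - 1)) \<le> real T powr (\<beta> ^ i * (2 * \<beta> - 1))"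
      using assms that \<beta> by (intro powr_mono mult_right_mono power_decreasing) auto
    also have "\<beta> ^ i * (2 * \<beta> - 1) = 2 * \<beta> ^ Suc i - \<beta> ^ i"
      by (simp add: algebra_simps)
    also have "real T powr \<dots> = (real T powr (\<beta> ^ Suc i))\<^sup>2 / real T powr (\<beta> ^ i)"
      using assms(3) by (simp add: powr_diff powr_power mult.commute)
    finally have "c\<^sup>2 * real T powr (\<beta> ^ M * (2 * \<beta> - 1)) \<le>
        c\<^sup>2 * ((real T powr (\<beta> ^ Suc i))\<^sup>2 / real T powr (\<beta> ^ i))"
      by (intro mult_left_mono) auto
    also have "\<dots> = 2 * (c * real T powr (\<beta> ^ Suc i))\<^sup>2 / (2 * real T powr (\<beta> ^ i))"
      by (simp add: power_mult_distrib)
    also have "\<dots> \<le> 2 * (c * real T powr (\<beta> ^ Suc i))\<^sup>2 / n"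
      using n \<open>n > 0\<close> assms(3) by (intro divide_left_mono) (auto simp: zero_less_mult_iff)
    finally have exp_le: "exp (- 2 * (c * real T powr (\<beta> ^ Suc i))\<^sup>2 / n) \<le>
        exp (- c\<^sup>2 * real T powr (\<beta> ^ M * (2 * \<beta> - 1)))"
      by simp
    have "?P (E i l j) \<le> 2 * exp (- 2 * (c * real T powr (\<beta> ^ Suc i))\<^sup>2 / n)"
      unfolding E_def n_def using assms(4) by (intro demand_from_tail epoch(1)) auto
    also have "\<dots> \<le> q"
      unfolding q_def by (intro mult_left_mono exp_le) simp
    finally show ?thesis .
  qed
  have "large_deviation p c \<beta> M T = (\<Union>i<M - 1. \<Union>l\<in>{i, Suc i}. \<Union>j. E i l j)"
    by (simp add: large_deviation_def E_def)
  also have "?P \<dots> \<le> (\<Sum>i<M - 1. ?P (\<Union>l\<in>{i, Suc i}. \<Union>j. E i l j))"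
    by (intro measure_pmf.finite_measure_subadditive_finite) auto
  also have "\<dots> \<le> (\<Sum>i<M - 1. \<Sum>l\<in>{i, Suc i}. ?P (\<Union>j. E i l j))"
    by (intro sum_mono measure_pmf.finite_measure_subadditive_finite) auto
  also have "\<dots> \<le> (\<Sum>i<M - 1. \<Sum>l\<in>{i, Suc i}. \<Sum>j\<in>UNIV. ?P (E i l j))"
    by (intro sum_mono measure_pmf.finite_measure_subadditive_finite) auto
  also have "\<dots> \<le> (\<Sum>i<M - 1. \<Sum>l\<in>{i, Suc i}. \<Sum>j\<in>(UNIV :: 'n set). q)"
    by (intro sum_mono E) auto
  also have "\<dots> = real (M - 1) * (2 * real CARD('n) * q)"
    by simp
  also have "\<dots> \<le> real M * (2 * real CARD('n) * q)"
    by (intro mult_right_mono) (auto simp: q_def)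
  finally show ?thesis
    by (simp add: q_def mult_ac)
qed

context airkp
begin

text \<open>For a position in epoch \<open>i\<close>, the deviation at the start of the epoch is the
  gap between planned and realised demand. The deviation at its end bounds the realised demand there
  from below, and since remaining demand only decreases, this bound holds throughout the
  epoch.\<close>

lemma lossless_unless_large_deviation:
  assumes \<beta>: "0 < \<beta>" "\<beta> < 1" and T: "T \<ge> 2" and M: "M \<ge> 1" and R: "R = resolving_set M \<beta> T"
    and K: "K \<ge> 0" and stable: "\<And>b d D u. 0 \<le> D \<Longrightarrow> lp_optimal A r b d u \<Longrightarrow>
      \<exists>y. lp_optimal A r b D y \<and> (\<forall>j. \<bar>y $ j - u $ j\<bar> \<le> K * (\<Sum>i\<in>UNIV. \<bar>d $ i - D $ i\<bar>))"
    and c: "c > 0" and pmin: "\<And>j. pmin \<le> pmf p j"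
    and K1: "K1 = 3 + 2 * K * real CARD('n)" and c_le: "2 * (c + K1 * c) \<le> pmin"
    and large: "2 * K1 \<le> pmin * real T powr (\<beta> ^ M)"
    and len: "length \<omega> = T" and \<omega>: "\<omega> \<notin> large_deviation p c \<beta> M T"
  defines "s \<equiv> epoch \<beta> T (M - 1)"
  shows "lp_value A r (real T *\<^sub>R \<rho>) (demand_from 0 \<omega>) =
    (\<Sum>k<s. gain \<omega> k) + lp_value A r (stock \<omega> s) (demand_from s \<omega>)"
proof (rule lossless_epochs[OF K stable len])
  note epoch = epoch_bounds[OF \<beta> T]
  show "s < T" unfolding s_def by (rule epoch(1))
  fix k assume "k < s"
  then obtain i where i: "i < M - 1" "epoch \<beta> T i \<le> k" "k < epoch \<beta> T (Suc i)"
    using epoch_containing[OF \<beta> T] unfolding s_def by blast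
  define w where "w = real T powr (\<beta> ^ Suc i)"
  have dev: "\<bar>demand_from (epoch \<beta> T l) \<omega> $ j - mean_demand (epoch \<beta> T l) $ j\<bar> \<le> c * w"
    if "l \<in> {i, Suc i}" for l j
    using \<omega> i(1) that by (auto simp: large_deviation_def mean_demand_def w_def not_le less_imp_le)
  have "K1 \<ge> 3" using K K1 by simp
  hence "0 \<le> K1 * c" using c by simp
  hence "pmin > 0" using c c_le by argo
  have "Suc (epoch \<beta> T i) \<in> R"
    using i(1) by (auto simp: R resolving_set_eq[OF \<beta> T M])
  hence plan: "planned_demand \<omega> k - demand_from k \<omega> =
      mean_demand (epoch \<beta> T i) - demand_from (epoch \<beta> T i) \<omega>"
    using i(2,3) \<open>k < s\<close> \<open>s < T\<close> len resolved_within_epoch[OF \<beta> T M, of i]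
    by (intro planned_demand_eq) (auto simp: R)
  have "\<bar>planned_demand \<omega> k $ j - demand_from k \<omega> $ j\<bar> \<le> c * w" for j
    using dev[of i j] arg_cong[OF plan, of "\<lambda>v. v $ j"] by simp
  moreover have "demand_from k \<omega> $ j \<ge> K1 * (c * w + 1)" for j
  proof -
    have "w \<ge> real T powr (\<beta> ^ M)"
      unfolding w_def using i(1) by (intro powr_power_antimono[OF \<beta> T]) auto
    hence "2 * K1 \<le> pmin * w"
      using large \<open>pmin > 0\<close> by (meson mult_left_mono less_imp_le order_trans)
    moreover have "2 * (c + K1 * c) * w \<le> pmin * w"
      using c_le by (intro mult_right_mono) (auto simp: w_def)
    \<comment> \<open>Half of \<open>pmin * w\<close> pays for \<open>K1\<close>, the other half for
      the terms in \<open>c\<close>.\<close>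
    ultimately have "K1 * (c * w + 1) \<le> pmin * w - c * w"
      by (simp add: algebra_simps)
    also have "pmin * w \<le> mean_demand (epoch \<beta> T (Suc i)) $ j"
      using mult_mono[OF pmin[of j] epoch(2)[of "Suc i"]] \<open>pmin > 0\<close>
      by (simp add: mean_demand_def w_def mult.commute)
    also have "mean_demand (epoch \<beta> T (Suc i)) $ j - c * w \<le> demand_from (epoch \<beta> T (Suc i)) \<omega> $ j"
      using dev[of "Suc i" j] by simp
    also have "\<dots> \<le> demand_from k \<omega> $ j"
      using i(3) by (intro demand_from_antimono) simp
    finally show ?thesis by simp
  qed
  ultimately show "\<exists>x\<ge>0. \<forall>j. \<bar>planned_demand \<omega> k $ j - demand_from k \<omega> $ j\<bar> \<le> x \<and>
      (3 + 2 * K * real CARD('n)) * (x + 1) \<le> demand_from k \<omega> $ j"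
    using c by (intro exI[of _ "c * w"]) (auto simp: K1 w_def)
qed

end

theorem theorem4:
  fixes A :: "real^'n::finite^'m::finite" and r :: "real^'n" and \<rho> :: "real^'m"
    and p :: "'n pmf" and M :: nat and \<epsilon> \<beta> :: real
  assumes "\<And>i j. A $ i $ j \<ge> 0" and "\<And>j. r $ j \<ge> 0" and "\<And>i. \<rho> $ i \<ge> 0"
    and "\<And>j. pmf p j > 0"
    and "M \<ge> 1" and "\<epsilon> > 0" and "1 / 2 < \<beta>" and "\<beta> < 1"
  shows "\<exists>C. \<forall>T \<ge> 1. \<forall>sol. lp_solver A r sol \<longrightarrow>
           regret A r \<rho> p T (airkp_policy A \<rho> p sol (resolving_set M \<beta> T) T)
             \<le> C * real T powr ((1 / 2 + \<epsilon>) * \<beta> ^ (M - 1))"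
proof -
  have \<beta>: "0 < \<beta>" using assms by simp
  obtain K where K: "K \<ge> 0" and stable: "\<And>r b d D u. 0 \<le> D \<Longrightarrow> lp_optimal A r b d u \<Longrightarrow>
      \<exists>y. lp_optimal A r b D y \<and> (\<forall>j. \<bar>y $ j - u $ j\<bar> \<le> K * (\<Sum>i\<in>UNIV. \<bar>d $ i - D $ i\<bar>))"
    by (rule lp_optimal_stable[of A, OF assms(1)]) (rule that)
  define rr where "rr = (\<Sum>j\<in>UNIV. r $ j)"
  have "rr \<ge> 0" unfolding rr_def using assms(2) by (intro sum_nonneg) auto
  define K1 where "K1 = 3 + 2 * K * real CARD('n)"
  have "K1 > 0" using K by (simp add: K1_def add_pos_nonneg)
  define pmin where "pmin = Min (range (pmf p))"
  have pmin: "pmin \<le> pmf p j" for j by (simp add: pmin_def)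
  have "pmin > 0" using assms(4) by (simp add: pmin_def)
  \<comment> \<open>The largest value with \<open>2 * (c + K1 * c) \<le> pmin\<close>.\<close>
  define c where "c = pmin / (2 * (1 + K1))"
  have "c > 0" using \<open>pmin > 0\<close> \<open>K1 > 0\<close> by (simp add: c_def)
  have "2 * (c + K1 * c) = c * (2 * (1 + K1))" by (simp add: algebra_simps)
  also have "\<dots> = pmin" using \<open>K1 > 0\<close> by (simp add: c_def)
  finally have c_le: "2 * (c + K1 * c) \<le> pmin" by simp
  define \<delta> where "\<delta> = \<beta> ^ M * (2 * \<beta> - 1)"
  have "\<delta> > 0" using assms \<beta> by (simp add: \<delta>_def)
  have "\<beta> ^ M > 0" using \<beta> by simp
  have "filterlim (\<lambda>x :: real. pmin * x powr (\<beta> ^ M)) at_top at_top"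
    using \<open>pmin > 0\<close> \<open>\<beta> ^ M > 0\<close> by real_asymp
  hence "eventually (\<lambda>n. 2 * K1 \<le> pmin * real n powr (\<beta> ^ M)) at_top"
    by (intro eventually_compose_filterlim[OF _ filterlim_real_sequentially])
       (simp add: filterlim_at_top)
  moreover have "eventually (\<lambda>n. real n * exp (- c\<^sup>2 * real n powr \<delta>) \<le> 1) at_top"
    using exp_powr_decay[of "c\<^sup>2" \<delta>] \<open>c > 0\<close> \<open>\<delta> > 0\<close> by simp
  ultimately have "eventually (\<lambda>n. 2 * K1 \<le> pmin * real n powr (\<beta> ^ M) \<and>
      real n * exp (- c\<^sup>2 * real n powr \<delta>) \<le> 1) at_top"
    by eventually_elim simp
  then obtain T0 where T0: "\<And>n. n \<ge> T0 \<Longrightarrow> 2 * K1 \<le> pmin * real n powr (\<beta> ^ M)"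
    "\<And>n. n \<ge> T0 \<Longrightarrow> real n * exp (- c\<^sup>2 * real n powr \<delta>) \<le> 1"
    by (auto simp: eventually_at_top_linorder)
  define N where "N = real (4 * M * CARD('n))"
  have "N \<ge> 0" by (simp add: N_def)
  \<comment> \<open>Small horizons satisfy \<open>T \<le> T0 + 2\<close>; for the others the bound
    \<open>1 + 4 * X + N\<close> is covered because \<open>X \<ge> 1\<close>.\<close>
  define C where "C = rr * (7 + N + real T0)"
  have "regret A r \<rho> p T (airkp_policy A \<rho> p sol (resolving_set M \<beta> T) T)
      \<le> C * real T powr ((1 / 2 + \<epsilon>) * \<beta> ^ (M - 1))"
    if "T \<ge> 1" and sol: "lp_solver A r sol" for T sol
  proof -
    interpret airkp A r \<rho> p sol "resolving_set M \<beta> T" T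
      using assms sol by unfold_locales (auto simp: less_eq_vec_def resolving_set_def)
    define X where "X = real T powr ((1 / 2 + \<epsilon>) * \<beta> ^ (M - 1))"
    have "X \<ge> 1"
      unfolding X_def using that(1) assms(6) \<beta> by (intro ge_one_powr_ge_zero) auto
    have "regret A r \<rho> p T (airkp_policy A \<rho> p sol (resolving_set M \<beta> T) T) \<le> C * X"
    proof (cases "T \<ge> T0 \<and> T \<ge> 2")
      case False
      have "regret A r \<rho> p T (airkp_policy A \<rho> p sol (resolving_set M \<beta> T) T) \<le> rr * real T"
        using regret_le_horizon by (simp add: rr_def)
      also have "\<dots> \<le> rr * (7 + N + real T0)"
      proof (intro mult_left_mono \<open>rr \<ge> 0\<close>)
        have "T \<le> T0 + 2" using False by linarith
        hence "real T \<le> real T0 + 2" by linarith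
        thus "real T \<le> 7 + N + real T0" using \<open>N \<ge> 0\<close> by linarith
      qed
      also have "\<dots> \<le> C * X"
        using \<open>X \<ge> 1\<close> \<open>rr \<ge> 0\<close> \<open>N \<ge> 0\<close> mult_left_mono[of 1 X C] by (simp add: C_def)
      finally show ?thesis .
    next
      case True
      note T = conjunct2[OF True]
      define s where "s = epoch \<beta> T (M - 1)"
      note epoch = epoch_bounds[OF \<beta> assms(8) T]
      define L where "L = large_deviation p c \<beta> M T"
      have "regret A r \<rho> p T (airkp_policy A \<rho> p sol (resolving_set M \<beta> T) T) \<le>
          rr * (1 + 2 * sqrt (real (T - s)) + real T * measure_pmf.prob (replicate_pmf T p) L)"
        unfolding rr_def
      proof (rule regret_le)
        show "s < T" unfolding s_def by (rule epoch(1))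
        show "Suc s \<in> resolving_set M \<beta> T"
          using assms(5) by (auto simp: resolving_set_eq[OF \<beta> assms(8) T] s_def)
        show "Suc l \<notin> resolving_set M \<beta> T" if "s < l" for l
          using that not_resolved_after_last_epoch[OF \<beta> assms(8) T assms(5)] by (simp add: s_def)
        show "lp_value A r (real T *\<^sub>R \<rho>) (demand_from 0 \<omega>) =
            (\<Sum>k<s. gain \<omega> k) + lp_value A r (stock \<omega> s) (demand_from s \<omega>)"
          if "length \<omega> = T" "\<omega> \<notin> L" for \<omega>
          unfolding s_def using that True
          by (intro lossless_unless_large_deviation[OF \<beta> assms(8) T assms(5) refl K stable
              \<open>c > 0\<close> pmin K1_def c_le]) (auto simp: T0(1) L_def)
      qed
      also have "\<dots> \<le> rr * (1 + 4 * X + N)"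
      proof (intro mult_left_mono add_mono \<open>rr \<ge> 0\<close> order_refl)
        \<comment> \<open>Square root of the order of the number of periods after the last
          re-solving; the factor 2 of \<open>epoch_bounds\<close> contributes
          \<open>sqrt 2 \<le> 2\<close>.\<close>
        define w where "w = real T powr (\<beta> ^ (M - 1) / 2)"
        have "real (T - s) \<le> 2 * real T powr (\<beta> ^ (M - 1))"
          using epoch(3)[of "M - 1"] by (simp add: s_def)
        also have "real T powr (\<beta> ^ (M - 1)) = w\<^sup>2"
          using T by (simp add: w_def powr_power)
        also have "2 * w\<^sup>2 \<le> (2 * w)\<^sup>2"
          by (simp add: power2_eq_square)
        finally have "sqrt (real (T - s)) \<le> 2 * w"
          by (intro real_le_lsqrt) (auto simp: w_def)
        also have "w \<le> X"
          unfolding w_def X_def using T assms(6) \<beta> by (intro powr_mono) (auto simp: algebra_simps)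
        finally show "2 * sqrt (real (T - s)) \<le> 4 * X" by simp
        have "real T * measure_pmf.prob (replicate_pmf T p) L \<le>
            real T * (N * exp (- c\<^sup>2 * real T powr \<delta>))"
          unfolding L_def N_def \<delta>_def using assms(7,8) T \<open>c > 0\<close>
          by (intro mult_left_mono prob_large_deviation) auto
        also have "\<dots> = N * (real T * exp (- c\<^sup>2 * real T powr \<delta>))" by simp
        also have "\<dots> \<le> N * 1"
          using T0(2)[of T] True \<open>N \<ge> 0\<close> by (intro mult_left_mono) auto
        finally show "real T * measure_pmf.prob (replicate_pmf T p) L \<le> N" by simp
      qed
      also have "\<dots> \<le> rr * ((7 + N + real T0) * X)"
      proof (intro mult_left_mono \<open>rr \<ge> 0\<close>)
        have "(1 + N) * 1 \<le> (3 + N + real T0) * X"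
          using \<open>X \<ge> 1\<close> \<open>N \<ge> 0\<close> by (intro mult_mono) auto
        thus "1 + 4 * X + N \<le> (7 + N + real T0) * X"
          by (simp add: algebra_simps)
      qed
      finally show ?thesis by (simp add: C_def)
    qed
    thus ?thesis by (simp add: X_def)
  qed
  thus ?thesis by blast
qed

end
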